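(* For every generalised Büchi automaton and every generalised coBüchi automaton $\mathcal{A}$: $\mathcal{A}$ is history-deterministic if and only if Eve wins the $G_2$ game on $\mathcal{A}$.
   Context: An automaton is a tuple $\mathcal{A}=(Q,\Sigma,q_{\mathrm{init}},\Delta,\Gamma,\mathrm{col},W)$ with finite state set, finite input alphabet $\Sigma$, initial state, transitions $\Delta\subseteq Q\times\Sigma\times Q$, output alphabet $\Gamma$, labelling $\mathrm{col}:\Delta\to\Gamma$, acceptance condition $W\subseteq\Gamma^\omega$. A run on $w=a_1a_2\cdots$ is a sequence $(q_0,a_1,q_1)(q_1,a_2,q_2)\cdots$ of transitions with $q_0=q_{\mathrm{init}}$, accepting if its label sequence is in $W$; $\mathcal{L}(\mathcal{A})$ is the set of words with an accepting run. With finite colour set $C$ and $\Gamma=2^C$: generalised Büchi means $W=\{x : \text{every } c\in C \text{ occurs in infinitely many letters of } x\}$; generalised coBüchi means $W=\{x : \text{some } c\in C \text{ occurs in only finitely many letters of } x\}$. A resolver is a map $\sigma:\Sigma^+\to\Delta$ such that for every $w=a_0a_1\cdots$, $\sigma(a_0)\sigma(a_0a_1)\cdots$ is a run on $w$, accepting whenever $w\in\mathcal{L}(\mathcal{A})$; history-deterministic means a resolver exists. The $G_2$ game on $\mathcal{A}$ is played between Eve and Adam on positions $Q^3$ starting at $(q_{\mathrm{init}},q_{\mathrm{init}},q_{\mathrm{init}})$; in each round from $(p,q_1,q_2)$, Adam chooses a letter $a\in\Sigma$, Eve chooses a transition $(p,a,p')\in\Delta$, Adam chooses transitions $(q_1,a,q_1'),(q_2,a,q_2')\in\Delta$,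 and the game moves to $(p',q_1',q_2')$. Eve wins a play if the run in the first component is accepting, or both runs in the second and third components are rejecting; Eve wins the game if she has a strategy winning all plays. *)

theory Defs
  imports Main
begin

type_synonym ('q,'a) trans = "'q \<times> 'a \<times> 'q"

record ('q,'a,'c) automaton =
  states   :: "'q set"
  alphabet :: "'a set"
  init     :: 'q
  delta    :: "('q,'a) trans set"
  colours  :: "'c set"
  col      :: "('q,'a) trans \<Rightarrow> 'c set"

definition wf_automaton :: "('q,'a,'c) automaton \<Rightarrow> bool" where
  "wf_automaton A \<longleftrightarrow> finite (states A) \<and> finite (alphabet A) \<and> init A \<in> states A
     \<and> delta A \<subseteq> states A \<times> alphabet A \<times> states A \<and> finite (colours A)
     \<and> (\<forall>t\<in>delta A. col A t \<subseteq> colours A)"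

definition gen_buchi :: "'c set \<Rightarrow> (nat \<Rightarrow> 'c set) \<Rightarrow> bool" where
  "gen_buchi C x \<longleftrightarrow> (\<forall>c\<in>C. \<exists>\<^sub>\<infinity>i. c \<in> x i)"

definition gen_cobuchi :: "'c set \<Rightarrow> (nat \<Rightarrow> 'c set) \<Rightarrow> bool" where
  "gen_cobuchi C x \<longleftrightarrow> (\<exists>c\<in>C. finite {i. c \<in> x i})"

definition src :: "('q,'a) trans \<Rightarrow> 'q" where "src t = fst t"
definition lbl :: "('q,'a) trans \<Rightarrow> 'a" where "lbl t = fst (snd t)"
definition tgt :: "('q,'a) trans \<Rightarrow> 'q" where "tgt t = snd (snd t)"

definition is_word :: "('q,'a,'c) automaton \<Rightarrow> (nat \<Rightarrow> 'a) \<Rightarrow> bool" where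
  "is_word A w \<longleftrightarrow> (\<forall>i. w i \<in> alphabet A)"

definition run_prefix :: "('q,'a,'c) automaton \<Rightarrow> (nat \<Rightarrow> 'a) \<Rightarrow> (nat \<Rightarrow> ('q,'a) trans) \<Rightarrow> nat \<Rightarrow> bool" where
  "run_prefix A w r n \<longleftrightarrow> (\<forall>i<n. r i \<in> delta A \<and> lbl (r i) = w i
      \<and> src (r i) = (if i = 0 then init A else tgt (r (i - 1))))"

definition is_run :: "('q,'a,'c) automaton \<Rightarrow> (nat \<Rightarrow> 'a) \<Rightarrow> (nat \<Rightarrow> ('q,'a) trans) \<Rightarrow> bool" where
  "is_run A w r \<longleftrightarrow> (\<forall>n. run_prefix A w r n)"

definition accepting :: "('q,'a,'c) automaton \<Rightarrow> ((nat \<Rightarrow> 'c set) \<Rightarrow> bool) \<Rightarrow> (nat \<Rightarrow> ('q,'a) trans) \<Rightarrow> bool" where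
  "accepting A W r \<longleftrightarrow> W (\<lambda>i. col A (r i))"

definition lang :: "('q,'a,'c) automaton \<Rightarrow> ((nat \<Rightarrow> 'c set) \<Rightarrow> bool) \<Rightarrow> (nat \<Rightarrow> 'a) set" where
  "lang A W = {w. is_word A w \<and> (\<exists>r. is_run A w r \<and> accepting A W r)}"

definition pref :: "(nat \<Rightarrow> 'a) \<Rightarrow> nat \<Rightarrow> 'a list" where
  "pref w n = map w [0..<n]"

definition is_resolver :: "('q,'a,'c) automaton \<Rightarrow> ((nat \<Rightarrow> 'c set) \<Rightarrow> bool)
    \<Rightarrow> ('a list \<Rightarrow> ('q,'a) trans) \<Rightarrow> bool" where
  "is_resolver A W \<sigma> \<longleftrightarrow> (\<forall>w. is_word A w \<longrightarrow>
      is_run A w (\<lambda>i. \<sigma> (pref w (Suc i)))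
      \<and> (w \<in> lang A W \<longrightarrow> accepting A W (\<lambda>i. \<sigma> (pref w (Suc i)))))"

definition history_deterministic :: "('q,'a,'c) automaton \<Rightarrow> ((nat \<Rightarrow> 'c set) \<Rightarrow> bool) \<Rightarrow> bool" where
  "history_deterministic A W \<longleftrightarrow> (\<exists>\<sigma>. is_resolver A W \<sigma>)"

text \<open>G2 game. An Eve strategy sees the letters a_0..a_i chosen by Adam so far and
  Adam's pairs of transitions from rounds 0..i-1 (her own earlier moves are determined
  by the strategy) and returns her transition for round i.
  Quantifying over all Adam move sequences covers all Adam strategies.\<close>
definition eve_play :: "('a list \<Rightarrow> (('q,'a) trans \<times> ('q,'a) trans) list \<Rightarrow> ('q,'a) trans)
    \<Rightarrow> (nat \<Rightarrow> 'a) \<Rightarrow> (nat \<Rightarrow> ('q,'a) trans) \<Rightarrow> (nat \<Rightarrow> ('q,'a) trans) \<Rightarrow> nat \<Rightarrow> ('q,'a) trans" where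
  "eve_play \<tau> w t1 t2 i = \<tau> (pref w (Suc i)) (map (\<lambda>j. (t1 j, t2 j)) [0..<i])"

text \<open>Eve wins with tau if (1) she always makes a legal move as long as Adam has made only
  legal moves (a player unable to move loses), and (2) in every infinite play
  her run is accepting or both of Adam's runs are rejecting.\<close>
definition eve_wins_G2 :: "('q,'a,'c) automaton \<Rightarrow> ((nat \<Rightarrow> 'c set) \<Rightarrow> bool) \<Rightarrow> bool" where
  "eve_wins_G2 A W \<longleftrightarrow> (\<exists>\<tau>.
     (\<forall>w t1 t2 n. is_word A w \<longrightarrow> run_prefix A w t1 n \<longrightarrow> run_prefix A w t2 n \<longrightarrow>
        run_prefix A w (eve_play \<tau> w t1 t2) (Suc n))
   \<and> (\<forall>w t1 t2. is_word A w \<longrightarrow> is_run A w t1 \<longrightarrow> is_run A w t2 \<longrightarrow>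
        accepting A W (eve_play \<tau> w t1 t2)
        \<or> (\<not> accepting A W t1 \<and> \<not> accepting A W t2)))"

end

theory Submission
  imports Defs "HOL-Library.Omega_Words_Fun" "HOL-Library.Countable_Set"
begin

text \<open>
  A resolver wins \<open>G2\<close> by ignoring Adam's tokens. For the converse, say that \<open>p\<close> dominates \<open>q\<close> if
  Eve, moving from \<open>p\<close>, beats one token of Adam that starts in \<open>q\<close>. Dominance is transitive, and
  the two-token strategy played against two identical tokens shows that the initial state
  dominates itself. A move is optimal if its target dominates the targets of all alternatives.
  Two-token strategies played against an accepting run and an optimal run yield an accepting
  optimal run. Hence one may restrict the automaton to optimal moves, after which all states
  reached by the same word dominate each other.

  In a one-token game Eve moves before Adam's token, so a chain of \<open>K\<close> copies of her strategy, each
  playing against the next, beats a token that moves with lookahead \<open>K\<close>.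

  For generalised Buchi conditions, call a word an event if every state of the current class has
  a run on it that sees all colours. If Eve cannot force the colour \<open>c\<close> before a bounded number of
  events, then Adam can avoid \<open>c\<close> forever while producing events within bounded time, and a token
  with lookahead that takes the promised runs beats Eve. So Eve obtains every colour in turn.

  For generalised coBuchi conditions, a run that eventually avoids \<open>c\<close> eventually stays in a
  strongly connected component of the transitions without \<open>c\<close>. Lookahead shows that for every state
  \<open>q\<close> some equivalent state can avoid some colour as long as \<open>q\<close> has a run inside its component.
  Eve follows the strategies so obtained, always for the first thread, that is, start of such a
  run in a fixed enumeration, that is still alive.
\<close>

section \<open>Infinite words\<close>

definition words :: "'a set \<Rightarrow> 'a word set" where
  "words Sg = {w. range w \<subseteq> Sg}"

lemma words_nth: "w \<in> words Sg \<Longrightarrow> w i \<in> Sg"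
  by (auto simp: words_def)

lemma words_eq_empty_iff: "words Sg = {} \<longleftrightarrow> Sg = {}"
  by (auto simp: words_def)

lemma conc_in_words [simp]: "u \<frown> w \<in> words Sg \<longleftrightarrow> set u \<subseteq> Sg \<and> w \<in> words Sg"
  by (simp add: words_def)

lemma suffix_in_words: "w \<in> words Sg \<Longrightarrow> suffix n w \<in> words Sg"
  by (auto simp: words_def)

lemma set_subsequence_words: "w \<in> words Sg \<Longrightarrow> set (w [i \<rightarrow> j]) \<subseteq> Sg"
  by (auto simp: words_def)

lemma prefix_eq_mono:
  assumes "prefix n w = prefix n w'" "m \<le> n"
  shows "prefix m w = prefix m w'"
  using arg_cong[OF assms(1), of "take m"] assms(2) by simp

lemma prefix_suffix_eq_drop: "prefix n (suffix m w) = drop m (prefix (m + n) w)"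
  by simp

lemma prefix_eq_append_subsequence: "m \<le> n \<Longrightarrow> prefix n w = prefix m w @ (w [m \<rightarrow> n])"
  using subsequence_append[of w m "n - m"] by (simp del: subseq_to_Suc)

lemma idx_sequence_ge: "idx_sequence T \<Longrightarrow> n \<le> T n"
  by (induction n) (auto simp: idx_sequence_def intro: le_less_trans Suc_leI)

lemma idx_sequence_all:
  assumes "idx_sequence T" "\<And>k. \<forall>y\<in>set (x [T k \<rightarrow> T (Suc k)]). P y"
  shows "P (x i)"
  using idx_sequence_interval[OF assms(1), of i] assms(2) by auto

lemma idx_sequence_INFM:
  assumes T: "idx_sequence T" and "\<exists>\<^sub>\<infinity>k. \<exists>y\<in>set (x [T k \<rightarrow> T (Suc k)]). P y"
  shows "\<exists>\<^sub>\<infinity>i. P (x i)"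
  unfolding INFM_nat_le
proof
  fix n
  obtain k where "n \<le> k" and k: "\<exists>y\<in>set (x [T k \<rightarrow> T (Suc k)]). P y"
    using assms(2) unfolding INFM_nat_le by blast
  moreover from k obtain i where "T k \<le> i" "P (x i)"
    by auto
  ultimately show "\<exists>i\<ge>n. P (x i)"
    using idx_sequence_ge[OF T, of k] by (meson le_trans)
qed

lemma increasing_lists_limit:
  fixes xs :: "nat \<Rightarrow> 'b list"
  assumes "xs 0 = []" and step: "\<And>k. \<exists>ys. ys \<noteq> [] \<and> xs (Suc k) = xs k @ ys"
  obtains x where "\<And>k. prefix (length (xs k)) x = xs k" "idx_sequence (\<lambda>k. length (xs k))"
proof (rule that)
  show idx: "idx_sequence (\<lambda>k. length (xs k))"
    unfolding idx_sequence_def using assms(1) step by (metis length_append length_greater_0_conv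
        less_add_same_cancel1 list.size(3))
  have extend: "\<exists>ys. xs (k + d) = xs k @ ys" for k d
  proof (induction d)
    case (Suc d)
    then show ?case
      using step[of "k + d"] by force
  qed simp
  show "prefix (length (xs k)) (\<lambda>i. xs (Suc i) ! i) = xs k" for k
  proof (rule nth_equalityI)
    fix i
    assume "i < length (prefix (length (xs k)) (\<lambda>i. xs (Suc i) ! i))"
    moreover have "i < length (xs (Suc i))"
      using idx_sequence_ge[OF idx, of "Suc i"] by simp
    moreover obtain ys zs where "xs k @ ys = xs (Suc i) @ zs"
      using extend[of k "Suc i"] extend[of "Suc i" k] by (metis add.commute)
    ultimately show "prefix (length (xs k)) (\<lambda>i. xs (Suc i) ! i) ! i = xs k ! i"
      using nth_append_left[of i "xs k" ys] nth_append_left[of i "xs (Suc i)" zs] by simp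
  qed simp
qed

lemma recurring_enumeration:
  assumes "countable C" "C \<noteq> {}"
  obtains e :: "'c word" where "\<And>j. e j \<in> C" "\<And>c. c \<in> C \<Longrightarrow> \<exists>\<^sub>\<infinity>j. e j = c"
proof (rule that)
  let ?e = "\<lambda>j. from_nat_into C (fst (prod_decode j))"
  show "?e j \<in> C" for j
    using assms(2) by (rule from_nat_into)
  show "\<exists>\<^sub>\<infinity>j. ?e j = c" if "c \<in> C" for c
    unfolding INFM_nat_le
  proof
    fix n
    have "?e (prod_encode (to_nat_on C c, n)) = c"
      using assms(1) that by simp
    then show "\<exists>j\<ge>n. ?e j = c"
      using le_prod_encode_2 by blast
  qed
qed

lemma Least_eventually_constant:
  fixes P :: "nat \<Rightarrow> nat \<Rightarrow> bool"
  assumes "\<forall>\<^sub>F n in sequentially. P j n"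
    and "\<And>i. (\<forall>\<^sub>F n in sequentially. P i n) \<or> (\<forall>\<^sub>F n in sequentially. \<not> P i n)"
  obtains i where "\<forall>\<^sub>F n in sequentially. (LEAST i. P i n) = i"
proof -
  define i where "i = (LEAST i. \<forall>\<^sub>F n in sequentially. P i n)"
  have "\<forall>\<^sub>F n in sequentially. P i n"
    unfolding i_def using assms(1) by (rule LeastI)
  moreover have "\<forall>\<^sub>F n in sequentially. \<forall>i'\<in>{..<i}. \<not> P i' n"
    using assms(2) not_less_Least unfolding i_def by (intro eventually_ball_finite) blast+
  ultimately have "\<forall>\<^sub>F n in sequentially. (LEAST i. P i n) = i"
    by eventually_elim (rule Least_equality, auto simp: not_less[symmetric])
  then show ?thesis
    by (rule that)
qed

section \<open>Runs\<close>

lemma src_lbl_tgt [simp]: "src (p, a, q) = p" "lbl (p, a, q) = a" "tgt (p, a, q) = q"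
  by (simp_all add: src_def lbl_def tgt_def)

primrec path :: "('s,'a) trans set \<Rightarrow> 's \<Rightarrow> ('s,'a) trans list \<Rightarrow> bool" where
  "path D p [] \<longleftrightarrow> True"
| "path D p (t # ts) \<longleftrightarrow> t \<in> D \<and> src t = p \<and> path D (tgt t) ts"

definition target :: "'s \<Rightarrow> ('s,'a) trans list \<Rightarrow> 's" where
  "target p ts = foldl (\<lambda>_. tgt) p ts"

definition finite_run :: "('s,'a) trans set \<Rightarrow> 's \<Rightarrow> 'a list \<Rightarrow> ('s,'a) trans list \<Rightarrow> bool" where
  "finite_run D p u ts \<longleftrightarrow> path D p ts \<and> map lbl ts = u"

definition run :: "('s,'a) trans set \<Rightarrow> 's \<Rightarrow> 'a word \<Rightarrow> ('s,'a) trans word \<Rightarrow> bool" where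
  "run D p w r \<longleftrightarrow> (\<forall>n. finite_run D p (prefix n w) (prefix n r))"

lemma target_simps [simp]:
  "target p [] = p" "target p (t # ts) = target (tgt t) ts"
  "target p (xs @ ys) = target (target p xs) ys"
  by (simp_all add: target_def)

lemma path_append [simp]: "path D p (xs @ ys) \<longleftrightarrow> path D p xs \<and> path D (target p xs) ys"
  by (induction xs arbitrary: p) auto

lemma path_subset: "path D p ts \<Longrightarrow> set ts \<subseteq> D"
  by (induction ts arbitrary: p) auto

lemma path_restrict: "path D p ts \<Longrightarrow> set ts \<subseteq> E \<Longrightarrow> path E p ts"
  by (induction ts arbitrary: p) auto

lemma finite_run_Nil [simp]: "finite_run D p [] []"
  by (simp add: finite_run_def)

lemma finite_run_length: "finite_run D p u ts \<Longrightarrow> length ts = length u"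
  by (auto simp: finite_run_def)

lemma finite_run_append:
  "length xs = length u \<Longrightarrow>
    finite_run D p (u @ v) (xs @ ys) \<longleftrightarrow> finite_run D p u xs \<and> finite_run D (target p xs) v ys"
  by (auto simp: finite_run_def)

lemma finite_run_snoc:
  "finite_run D p (u @ [a]) (ts @ [t]) \<longleftrightarrow>
    finite_run D p u ts \<and> t \<in> D \<and> src t = target p ts \<and> lbl t = a"
  by (auto simp: finite_run_def)

lemma finite_run_take:
  assumes "finite_run D p u ts"
  shows "finite_run D p (take n u) (take n ts)"
proof -
  have "finite_run D p (take n u @ drop n u) (take n ts @ drop n ts)"
    using assms by simp
  then show ?thesis
    using finite_run_length[OF assms] by (subst (asm) finite_run_append) auto
qed

lemma finite_run_prefix:
  "finite_run D p (prefix n w) (prefix n r) \<Longrightarrow> m \<le> n \<Longrightarrow> finite_run D p (prefix m w) (prefix m r)"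
  using finite_run_take[of D p "prefix n w" "prefix n r" m] by simp

lemma finite_run_restrict:
  "finite_run D p u ts \<Longrightarrow> set ts \<subseteq> E \<Longrightarrow> finite_run E p u ts"
  by (auto simp: finite_run_def intro: path_restrict)

lemma finite_run_mono: "finite_run D p u ts \<Longrightarrow> D \<subseteq> E \<Longrightarrow> finite_run E p u ts"
  by (meson finite_run_def finite_run_restrict path_subset subset_trans)

lemma run_finite_run: "run D p w r \<Longrightarrow> finite_run D p (prefix n w) (prefix n r)"
  by (simp add: run_def)

lemma run_iff:
  "run D p w r \<longleftrightarrow> (\<forall>i. r i \<in> D \<and> lbl (r i) = w i \<and> src (r i) = target p (prefix i r))"
proof
  assume "run D p w r"
  then have "finite_run D p (prefix (Suc i) w) (prefix (Suc i) r)" for i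
    by (rule run_finite_run)
  then show "\<forall>i. r i \<in> D \<and> lbl (r i) = w i \<and> src (r i) = target p (prefix i r)"
    by (simp add: finite_run_snoc)
next
  assume steps: "\<forall>i. r i \<in> D \<and> lbl (r i) = w i \<and> src (r i) = target p (prefix i r)"
  have "finite_run D p (prefix n w) (prefix n r)" for n
    by (induction n) (use steps in \<open>simp_all add: finite_run_snoc\<close>)
  then show "run D p w r"
    by (simp add: run_def)
qed

lemma run_conc_iff:
  assumes "length ts = length u"
  shows "run D p (u \<frown> w) (ts \<frown> r) \<longleftrightarrow> finite_run D p u ts \<and> run D (target p ts) w r"
proof
  assume run: "run D p (u \<frown> w) (ts \<frown> r)"
  have "finite_run D p (u @ prefix n w) (ts @ prefix n r)" for n
    using run_finite_run[OF run, of "length u + n"] assms by simp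
  then show "finite_run D p u ts \<and> run D (target p ts) w r"
    using assms by (simp add: finite_run_append run_def)
next
  assume runs: "finite_run D p u ts \<and> run D (target p ts) w r"
  have "finite_run D p (prefix n (u \<frown> w)) (prefix n (ts \<frown> r))" for n
  proof (cases "n \<le> length u")
    case True
    then show ?thesis
      using runs finite_run_take[of D p u ts n] assms by simp
  next
    case False
    then show ?thesis
      using runs run_finite_run[of D "target p ts" w r] assms by (simp add: finite_run_append)
  qed
  then show "run D p (u \<frown> w) (ts \<frown> r)"
    by (simp add: run_def)
qed

lemma run_suffix:
  "run D p w r \<Longrightarrow> run D (target p (prefix n r)) (suffix n w) (suffix n r)"
  using run_conc_iff[of "prefix n r" "prefix n w" D p "suffix n w" "suffix n r"] by simp

lemma run_subsequence:
  assumes "run D p w r"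
  shows "finite_run D (target p (prefix m r)) (w [m \<rightarrow> n]) (r [m \<rightarrow> n])"
  using run_finite_run[OF run_suffix[OF assms, of m], of "n - m"]
  by (simp add: subsequence_prefix_suffix del: subsequence_shift)

lemma run_limit:
  assumes T: "idx_sequence T" and path: "\<And>k. path D p (prefix (T k) r)"
  shows "run D p (lbl \<circ> r) r"
  unfolding run_def
proof
  fix n
  have "finite_run D p (prefix (T n) (lbl \<circ> r)) (prefix (T n) r)"
    using path[of n] by (simp add: finite_run_def subsequence_def)
  then show "finite_run D p (prefix n (lbl \<circ> r)) (prefix n r)"
    using idx_sequence_ge[OF T] by (rule finite_run_prefix)
qed

lemma run_mono: "run D p w r \<Longrightarrow> D \<subseteq> E \<Longrightarrow> run E p w r"
  by (meson finite_run_mono run_def)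

locale finite_graph =
  fixes D :: "('s,'a) trans set" and Sg :: "'a set" and V :: "'s set"
  assumes finite_V: "finite V" and finite_Sg: "finite Sg" and Sg_nonempty: "Sg \<noteq> {}"
    and D_subset: "D \<subseteq> V \<times> Sg \<times> V"
begin

lemma finite_D: "finite D"
  using D_subset finite_V finite_Sg by (meson finite_SigmaI finite_subset)

lemma transD: "t \<in> D \<Longrightarrow> src t \<in> V \<and> lbl t \<in> Sg \<and> tgt t \<in> V"
  using D_subset by (cases t) auto

lemma target_in_V: "path D p ts \<Longrightarrow> p \<in> V \<Longrightarrow> target p ts \<in> V"
  by (induction ts arbitrary: p) (auto simp: transD)

lemma path_labels: "path D p ts \<Longrightarrow> lbl ` set ts \<subseteq> Sg"
  by (induction ts arbitrary: p) (auto simp: transD)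

end

section \<open>Causal operators\<close>

definition causal :: "('a word \<Rightarrow> 'b word) \<Rightarrow> bool" where
  "causal R \<longleftrightarrow> (\<forall>w w' n. prefix n w = prefix n w' \<longrightarrow> prefix n (R w) = prefix n (R w'))"

definition delayed :: "nat \<Rightarrow> ('a word \<Rightarrow> 'b word \<Rightarrow> 'c word) \<Rightarrow> bool" where
  "delayed K F \<longleftrightarrow> (\<forall>w w' t t' n. prefix n w = prefix n w' \<longrightarrow>
     prefix (n - K) t = prefix (n - K) t' \<longrightarrow> prefix n (F w t) = prefix n (F w' t'))"

lemma causalD: "causal R \<Longrightarrow> prefix n w = prefix n w' \<Longrightarrow> prefix n (R w) = prefix n (R w')"
  unfolding causal_def by blast

lemma causal_const: "causal (\<lambda>_. r)"
  by (simp add: causal_def)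

lemma delayedD:
  "delayed K F \<Longrightarrow> prefix n w = prefix n w' \<Longrightarrow> prefix (n - K) t = prefix (n - K) t' \<Longrightarrow>
    prefix n (F w t) = prefix n (F w' t')"
  unfolding delayed_def by blast

lemma delayed_antimono: "delayed K F \<Longrightarrow> M \<le> K \<Longrightarrow> delayed M F"
  unfolding delayed_def by (meson diff_le_mono2 prefix_eq_mono)

lemma delayed_compose:
  fixes F :: "'a word \<Rightarrow> 'b word \<Rightarrow> 'c word" and G :: "'a word \<Rightarrow> 'd word \<Rightarrow> 'b word"
  assumes "delayed K F" "delayed M G"
  shows "delayed (M + K) (\<lambda>w t. F w (G w t))"
  unfolding delayed_def
proof (intro allI impI)
  fix w w' :: "'a word" and t t' :: "'d word" and n
  assume w: "prefix n w = prefix n w'" and "prefix (n - (M + K)) t = prefix (n - (M + K)) t'"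
  then have "prefix (n - K - M) t = prefix (n - K - M) t'"
    by (simp add: add.commute)
  then have "prefix (n - K) (G w t) = prefix (n - K) (G w' t')"
    by (rule delayedD[OF assms(2) prefix_eq_mono[OF w diff_le_self]])
  then show "prefix n (F w (G w t)) = prefix n (F w' (G w' t'))"
    by (rule delayedD[OF assms(1) w])
qed

lemma causal_delayed:
  fixes R :: "'a word \<Rightarrow> 'b word"
  assumes "delayed K F" "causal R"
  shows "causal (\<lambda>w. F w (R w))"
  unfolding causal_def
proof (intro allI impI)
  fix w w' :: "'a word" and n
  assume w: "prefix n w = prefix n w'"
  show "prefix n (F w (R w)) = prefix n (F w' (R w'))"
    by (rule delayedD[OF assms(1) w causalD[OF assms(2) prefix_eq_mono[OF w diff_le_self]]])
qed

lemma delayed_residual: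
  assumes "delayed K F" "length ts = length u"
  shows "delayed K (\<lambda>w t. suffix (length u) (F (u \<frown> w) (ts \<frown> t)))"
  unfolding delayed_def
proof (intro allI impI)
  fix w w' :: "'a word" and t t' :: "'b word" and n
  assume "prefix n w = prefix n w'" and t: "prefix (n - K) t = prefix (n - K) t'"
  then have "prefix (length u + n) (u \<frown> w) = prefix (length u + n) (u \<frown> w')"
    by simp
  moreover have "prefix (length u + n - K) (ts \<frown> t) = prefix (length u + n - K) (ts \<frown> t')"
    using assms(2) t by (cases "K \<le> n") simp_all
  ultimately have "prefix (length u + n) (F (u \<frown> w) (ts \<frown> t))
      = prefix (length u + n) (F (u \<frown> w') (ts \<frown> t'))"
    by (rule delayedD[OF assms(1)])
  then show "prefix n (suffix (length u) (F (u \<frown> w) (ts \<frown> t)))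
      = prefix n (suffix (length u) (F (u \<frown> w') (ts \<frown> t')))"
    by (simp only: prefix_suffix_eq_drop)
qed

lemma causal_residual:
  fixes R :: "'a word \<Rightarrow> 'b word"
  assumes "causal R"
  shows "causal (\<lambda>w. suffix (length u) (R (u \<frown> w)))"
  unfolding causal_def
proof (intro allI impI)
  fix w w' :: "'a word" and n
  assume "prefix n w = prefix n w'"
  then have "prefix (length u + n) (u \<frown> w) = prefix (length u + n) (u \<frown> w')"
    by simp
  from causalD[OF assms this]
  show "prefix n (suffix (length u) (R (u \<frown> w))) = prefix n (suffix (length u) (R (u \<frown> w')))"
    by (simp only: prefix_suffix_eq_drop)
qed

lemma causal_first_letter:
  assumes "causal R"
  shows "prefix (Suc n) (R ([a] \<frown> w)) = R (\<lambda>_. a) 0 # prefix n (suffix 1 (R ([a] \<frown> w)))"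
  using subsequence_append[of "R ([a] \<frown> w)" 1 n] causalD[OF assms, of "[a] \<frown> w" 1 "\<lambda>_. a"]
  by simp

section \<open>Strategies\<close>

definition strategy ::
  "('s,'a) trans set \<Rightarrow> 'a set \<Rightarrow> 's \<Rightarrow> ('a word \<Rightarrow> ('s,'a) trans word) \<Rightarrow> bool" where
  "strategy D Sg p R \<longleftrightarrow> causal R \<and> (\<forall>w\<in>words Sg. run D p w (R w))"

lemma strategy_causal: "strategy D Sg p R \<Longrightarrow> causal R"
  by (simp add: strategy_def)

lemma strategy_run: "strategy D Sg p R \<Longrightarrow> w \<in> words Sg \<Longrightarrow> run D p w (R w)"
  by (simp add: strategy_def)

lemma strategy_mono: "strategy D Sg p R \<Longrightarrow> D \<subseteq> E \<Longrightarrow> strategy E Sg p R"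
  by (auto simp: strategy_def intro: run_mono)

lemma strategy_residual:
  assumes "Sg \<noteq> {}" and R: "strategy D Sg p R" and u: "set u \<subseteq> Sg"
  obtains ts where "finite_run D p u ts"
    "strategy D Sg (target p ts) (\<lambda>w. suffix (length u) (R (u \<frown> w)))"
proof -
  obtain v where "v \<in> words Sg"
    using assms(1) words_eq_empty_iff by blast
  define ts where "ts = prefix (length u) (R (u \<frown> v))"
  have ts: "prefix (length u) (R (u \<frown> w)) = ts" for w
    unfolding ts_def by (rule causalD[OF strategy_causal[OF R]]) simp
  have run: "run D p (u \<frown> w) (R (u \<frown> w))" if "w \<in> words Sg" for w
    using strategy_run[OF R] u that by simp
  have "finite_run D p u ts"
    using run_finite_run[OF run[OF \<open>v \<in> words Sg\<close>], of "length u"] by (simp add: ts)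
  moreover have "strategy D Sg (target p ts) (\<lambda>w. suffix (length u) (R (u \<frown> w)))"
    unfolding strategy_def
    using causal_residual[OF strategy_causal[OF R]] run_suffix[OF run, of _ "length u"]
    by (simp add: ts)
  ultimately show ?thesis
    by (rule that)
qed

lemma history_strategy:
  assumes "Inv []"
    and step: "\<And>h a. Inv h \<Longrightarrow> a \<in> Sg \<Longrightarrow> \<exists>t\<in>D. src t = target p h \<and> lbl t = a \<and> Inv (h @ [t])"
  shows "\<exists>R. strategy D Sg p R \<and> (\<forall>w\<in>words Sg. \<forall>n. Inv (prefix n (R w)))"
proof -
  obtain \<sigma> where \<sigma>: "\<And>h a. Inv h \<Longrightarrow> a \<in> Sg \<Longrightarrow>
      \<sigma> h a \<in> D \<and> src (\<sigma> h a) = target p h \<and> lbl (\<sigma> h a) = a \<and> Inv (h @ [\<sigma> h a])"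
    using step by metis
  define history where "history u = foldl (\<lambda>h a. h @ [\<sigma> h a]) [] u" for u
  define R where "R w i = \<sigma> (history (prefix i w)) (w i)" for w i
  have prefix_R: "prefix n (R w) = history (prefix n w)" for n w
    by (induction n) (simp_all add: history_def R_def)
  then have R_nth: "R w i = \<sigma> (prefix i (R w)) (w i)" for w i
    by (simp add: R_def)
  have Inv: "Inv (prefix n (R w))" if "w \<in> words Sg" for w n
  proof (induction n)
    case (Suc n)
    then show ?case
      using \<sigma>[OF Suc words_nth[OF that, of n]] R_nth[of w n] by simp
  qed (use assms(1) in simp)
  have "run D p w (R w)" if "w \<in> words Sg" for w
    using \<sigma> Inv[OF that] words_nth[OF that] by (simp add: run_iff R_nth[of w])
  moreover have "causal R"
    by (simp add: causal_def prefix_R)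
  ultimately show ?thesis
    using Inv unfolding strategy_def by blast
qed

section \<open>Restarting strategies\<close>

text \<open>Eve restarts whenever the value of \<open>f\<close> changes: at step \<open>n\<close> she follows the strategy that
  was started at step \<open>last_change f n\<close>.\<close>

primrec last_change :: "'b word \<Rightarrow> nat \<Rightarrow> nat" where
  "last_change f 0 = 0"
| "last_change f (Suc n) = (if f (Suc n) = f n then last_change f n else Suc n)"

lemma last_change_le: "last_change f n \<le> n"
  by (induction n) auto

lemma last_change_cong: "(\<And>k. k \<le> n \<Longrightarrow> f k = g k) \<Longrightarrow> last_change f n = last_change g n"
  by (induction n) auto

lemma last_change_constant: "last_change f n \<le> k \<Longrightarrow> k \<le> n \<Longrightarrow> f k = f n"
  by (induction n) (auto simp: le_Suc_eq split: if_splits)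

lemma last_change_stable:
  assumes stable: "\<And>k. k \<ge> N \<Longrightarrow> f k = f N" and "N \<le> n"
  shows "last_change f n = last_change f N"
  using \<open>N \<le> n\<close>
proof (induction n rule: dec_induct)
  case (step n)
  then have "f (Suc n) = f n"
    using stable[of n] stable[of "Suc n"] by simp
  then show ?case
    using step.IH by simp
qed simp

definition follows ::
  "('b list \<Rightarrow> 'a word \<Rightarrow> 'b word) \<Rightarrow> 'i word \<Rightarrow> 'a word \<Rightarrow> 'b list \<Rightarrow> bool" where
  "follows Z f w h \<longleftrightarrow> (let s = last_change f (length h) in
     drop s h = prefix (length h - s) (Z (take s h) (suffix s w)))"

lemma follows_Nil [simp]: "follows Z f w []"
  by (simp add: follows_def)

lemma follows_snoc:
  assumes "follows Z f w h" and "s = last_change f (length h)"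
  shows "follows Z f w (h @ [Z (take s h) (suffix s w) (length h - s)])"
  using assms last_change_le[of f "length h"] by (simp add: follows_def Let_def Suc_diff_le)

lemma follows_cong:
  assumes "\<And>h. causal (Z h)" "prefix (length h) w = prefix (length h) w'"
    and "\<And>k. k \<le> length h \<Longrightarrow> f k = g k"
  shows "follows Z f w h \<longleftrightarrow> follows Z g w' h"
proof -
  define s where "s = last_change f (length h)"
  have s: "s = last_change g (length h)" "s \<le> length h"
    using last_change_cong[of "length h" f g, OF assms(3)] last_change_le[of g]
    by (simp_all add: s_def)
  have "prefix (length h - s) (suffix s w) = prefix (length h - s) (suffix s w')"
    using s(2) assms(2) by (simp only: prefix_suffix_eq_drop le_add_diff_inverse)
  from causalD[OF assms(1) this]
  show ?thesis
    by (simp add: follows_def flip: s_def s(1))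
qed

lemma follows_limit:
  assumes follows: "\<And>n. follows Z f w (prefix n r)" and stable: "\<And>n. n \<ge> N \<Longrightarrow> f n = f N"
  obtains s where "\<And>n. n \<ge> s \<Longrightarrow> f n = f s" "suffix s r = Z (prefix s r) (suffix s w)"
proof (rule that)
  let ?s = "last_change f N"
  have const: "f n = f N" if "n \<ge> ?s" for n
  proof (cases "n \<le> N")
    case True
    with that show ?thesis by (rule last_change_constant)
  next
    case False
    then show ?thesis by (intro stable) simp
  qed
  then show "f n = f ?s" if "n \<ge> ?s" for n
    using const[OF that] const[of ?s] by simp
  show "suffix ?s r = Z (prefix ?s r) (suffix ?s w)"
  proof
    fix i
    define n where "n = max N (Suc (?s + i))"
    have n: "last_change f n = ?s" "?s + i < n" "?s \<le> n"
      using last_change_stable[of N f n, OF stable] by (auto simp: n_def)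
    have "r [?s \<rightarrow> n] = prefix (n - ?s) (Z (prefix ?s r) (suffix ?s w))"
      using follows[of n] n by (simp add: follows_def Let_def min_absorb1)
    from arg_cong[OF this, of "\<lambda>ts. ts ! i"] n(2)
    show "suffix ?s r i = Z (prefix ?s r) (suffix ?s w) i"
      by simp
  qed
qed

lemma follows_legal:
  assumes follows: "follows Z f w h" and s: "s = last_change f (length h)"
    and Z: "run D (target p (take s h)) (suffix s w) (Z (take s h) (suffix s w))"
  shows "let t = Z (take s h) (suffix s w) (length h - s)
    in t \<in> D \<and> src t = target p h \<and> lbl t = w (length h)"
proof -
  have "s \<le> length h"
    using s last_change_le by simp
  moreover have "target (target p (take s h)) (drop s h) = target p h"
    by (simp flip: target_simps(3))
  ultimately show ?thesis
    using Z follows s unfolding run_iff follows_def Let_def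
    by (simp add: spec[of _ "length h - s"])
qed

definition restarting_history ::
  "('s,'a) trans set \<Rightarrow> 'a set \<Rightarrow> 's \<Rightarrow> (('s,'a) trans list \<Rightarrow> 'a word \<Rightarrow> ('s,'a) trans word) \<Rightarrow>
    ('a list \<Rightarrow> 'i) \<Rightarrow> ('s,'a) trans list \<Rightarrow> bool" where
  "restarting_history D Sg p Z \<iota> h \<longleftrightarrow> path D p h \<and> lbl ` set h \<subseteq> Sg \<and>
     (\<forall>w. prefix (length h) w = map lbl h \<longrightarrow> follows Z (\<lambda>k. \<iota> (prefix k w)) w h)"

lemma restarting_history_step:
  assumes causal: "\<And>h. causal (Z h)"
    and Z: "\<And>h. path D p h \<Longrightarrow> strategy D Sg (target p h) (Z h)"
    and h: "restarting_history D Sg p Z \<iota> h" and a: "a \<in> Sg"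
  shows "\<exists>t\<in>D. src t = target p h \<and> lbl t = a \<and> restarting_history D Sg p Z \<iota> (h @ [t])"
proof -
  let ?f = "\<lambda>w k. \<iota> (prefix k w)"
  define w where "w = (map lbl h @ [a]) \<frown> (\<lambda>_. a)"
  define s where "s = last_change (?f w) (length h)"
  define t where "t = Z (take s h) (suffix s w) (length h - s)"
  have w: "w \<in> words Sg" "prefix (length h) w = map lbl h" "w (length h) = a"
    using h a by (auto simp: w_def restarting_history_def words_def)
  have "path D p (take s h)"
    using h path_append[of D p "take s h" "drop s h"] by (simp add: restarting_history_def)
  then have t: "t \<in> D" "src t = target p h" "lbl t = a"
    using follows_legal[OF _ s_def, of Z w D p] h w strategy_run[OF Z suffix_in_words[OF w(1)]]
    by (simp_all add: restarting_history_def t_def Let_def)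
  have "follows Z (?f w') w' (h @ [t])"
    if w': "prefix (length (h @ [t])) w' = map lbl (h @ [t])" for w'
  proof -
    have eq: "prefix (length (h @ [t])) w = prefix (length (h @ [t])) w'"
      unfolding w' by (simp add: w_def t(3))
    have "follows Z (?f w) w (h @ [t]) \<longleftrightarrow> follows Z (?f w') w' (h @ [t])"
      by (intro follows_cong causal eq arg_cong[where f = \<iota>] prefix_eq_mono[OF eq])
    moreover have "follows Z (?f w) w (h @ [t])"
      unfolding t_def using h w(2) by (intro follows_snoc s_def) (auto simp: restarting_history_def)
    ultimately show ?thesis
      by simp
  qed
  then have "restarting_history D Sg p Z \<iota> (h @ [t])"
    using h t a by (auto simp: restarting_history_def)
  with t show ?thesis
    by blast
qed

lemma restarting_history_limit:
  assumes history: "\<And>n. restarting_history D Sg p Z \<iota> (prefix n r)" and r: "run D p w r"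
    and stable: "\<forall>n\<ge>N. \<iota> (prefix n w) = \<iota> (prefix N w)"
  shows "\<exists>s. (\<forall>n\<ge>s. \<iota> (prefix n w) = \<iota> (prefix s w)) \<and>
    suffix s r = Z (prefix s r) (suffix s w)"
proof -
  have "prefix (length (prefix n r)) w = map lbl (prefix n r)" for n
    using run_finite_run[OF r, of n] by (simp add: finite_run_def)
  then have "follows Z (\<lambda>k. \<iota> (prefix k w)) w (prefix n r)" for n
    using history[of n] unfolding restarting_history_def by blast
  from follows_limit[OF this stable[rule_format]] show ?thesis
    by metis
qed

lemma restarting_strategy:
  fixes \<iota> :: "'a list \<Rightarrow> 'i"
  assumes causal: "\<And>h. causal (Z h)"
    and Z: "\<And>h. path D p h \<Longrightarrow> strategy D Sg (target p h) (Z h)"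
  shows "\<exists>R. strategy D Sg p R \<and> (\<forall>w\<in>words Sg. \<forall>N.
    (\<forall>n\<ge>N. \<iota> (prefix n w) = \<iota> (prefix N w)) \<longrightarrow>
    (\<exists>s. (\<forall>n\<ge>s. \<iota> (prefix n w) = \<iota> (prefix s w)) \<and>
      suffix s (R w) = Z (prefix s (R w)) (suffix s w)))"
proof -
  have "restarting_history D Sg p Z \<iota> []"
    by (simp add: restarting_history_def)
  from history_strategy[of "restarting_history D Sg p Z \<iota>" Sg D p, OF this]
  obtain R where R: "strategy D Sg p R"
    and history: "\<forall>w\<in>words Sg. \<forall>n. restarting_history D Sg p Z \<iota> (prefix n (R w))"
    using restarting_history_step[OF causal Z] by metis
  have "\<exists>s. (\<forall>n\<ge>s. \<iota> (prefix n w) = \<iota> (prefix s w)) \<and>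
      suffix s (R w) = Z (prefix s (R w)) (suffix s w)"
    if w: "w \<in> words Sg" and N: "\<forall>n\<ge>N. \<iota> (prefix n w) = \<iota> (prefix N w)" for w N
  proof -
    have "restarting_history D Sg p Z \<iota> (prefix n (R w))" for n
      using history w by blast
    then show ?thesis
      by (rule restarting_history_limit[OF _ strategy_run[OF R w] N])
  qed
  with R show ?thesis
    by blast
qed

lemma restarting_strategy_achieves:
  fixes \<iota> :: "'a list \<Rightarrow> 'i" and D :: "('s,'a) trans set"
    and achieves :: "('s,'a) trans list \<Rightarrow> 'a word \<Rightarrow> ('s,'a) trans word \<Rightarrow> bool"
  assumes ex: "\<And>h. path D p h \<Longrightarrow>
    \<exists>Z. strategy D Sg (target p h) Z \<and> (\<forall>w\<in>words Sg. achieves h w (Z w))"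
  shows "\<exists>R. strategy D Sg p R \<and> (\<forall>w\<in>words Sg. \<forall>N.
    (\<forall>n\<ge>N. \<iota> (prefix n w) = \<iota> (prefix N w)) \<longrightarrow>
    (\<exists>s. (\<forall>n\<ge>s. \<iota> (prefix n w) = \<iota> (prefix s w)) \<and>
      achieves (prefix s (R w)) (suffix s w) (suffix s (R w))))"
proof -
  have "\<exists>Z. causal Z \<and> (path D p h \<longrightarrow>
      strategy D Sg (target p h) Z \<and> (\<forall>w\<in>words Sg. achieves h w (Z w)))" for h
  proof (cases "path D p h")
    case True
    then show ?thesis
      using ex[of h] strategy_causal[of D Sg "target p h"] by metis
  qed (use causal_const in blast)
  then obtain Z where causal: "\<And>h. causal (Z h)"
    and Z: "\<And>h. path D p h \<Longrightarrow> strategy D Sg (target p h) (Z h)"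
    and achieves: "\<And>h w. path D p h \<Longrightarrow> w \<in> words Sg \<Longrightarrow> achieves h w (Z h w)"
    by metis
  obtain R where R: "strategy D Sg p R"
    and restart: "\<And>w N. w \<in> words Sg \<Longrightarrow> \<forall>n\<ge>N. \<iota> (prefix n w) = \<iota> (prefix N w) \<Longrightarrow>
      \<exists>s. (\<forall>n\<ge>s. \<iota> (prefix n w) = \<iota> (prefix s w)) \<and>
        suffix s (R w) = Z (prefix s (R w)) (suffix s w)"
    using restarting_strategy[of Z D p Sg \<iota>, OF causal Z] by blast
  have "achieves (prefix s (R w)) (suffix s w) (Z (prefix s (R w)) (suffix s w))"
    if w: "w \<in> words Sg" for w s
    using achieves[OF _ suffix_in_words[OF w]] run_finite_run[OF strategy_run[OF R w]]
    unfolding finite_run_def by blast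
  with R restart show ?thesis
    by metis
qed

section \<open>One-token games\<close>

definition resolvable ::
  "('s,'a) trans set \<Rightarrow> 'a set \<Rightarrow> (('s,'a) trans word \<Rightarrow> bool) \<Rightarrow> 's \<Rightarrow> bool" where
  "resolvable D Sg acc p \<longleftrightarrow> (\<exists>R. strategy D Sg p R \<and>
     (\<forall>w\<in>words Sg. (\<exists>r. run D p w r \<and> acc r) \<longrightarrow> acc (R w)))"

locale token_game =
  fixes D :: "('s,'a) trans set" and Sg :: "'a set" and acc :: "('s,'a) trans word \<Rightarrow> bool"
  assumes acc_suffix [simp]: "acc (suffix n r) \<longleftrightarrow> acc r"
begin

lemma acc_conc [simp]: "acc (ts \<frown> r) \<longleftrightarrow> acc r"
  using acc_suffix[of "length ts" "ts \<frown> r"] by simp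

text \<open>Eve's move for a letter may depend on all but the last \<open>K\<close> moves of the token, which sees
  that letter before it moves. She has to stay alive only as long as the token does.\<close>

definition beats ::
  "nat \<Rightarrow> ('a word \<Rightarrow> ('s,'a) trans word \<Rightarrow> ('s,'a) trans word) \<Rightarrow> 's \<Rightarrow> 's \<Rightarrow> bool" where
  "beats K F p q \<longleftrightarrow> delayed K F \<and> (\<forall>w\<in>words Sg. \<forall>t.
     (\<forall>n. finite_run D q (prefix n w) (prefix n t) \<longrightarrow>
        finite_run D p (prefix (n + K) w) (prefix (n + K) (F w t))) \<and>
     (run D q w t \<longrightarrow> acc t \<longrightarrow> acc (F w t)))"

definition dominates :: "'s \<Rightarrow> 's \<Rightarrow> bool" where
  "dominates p q \<longleftrightarrow> (\<exists>F. beats 1 F p q)"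

lemma beats_delayed: "beats K F p q \<Longrightarrow> delayed K F"
  by (simp add: beats_def)

lemma beats_legal:
  "beats K F p q \<Longrightarrow> w \<in> words Sg \<Longrightarrow> finite_run D q (prefix n w) (prefix n t) \<Longrightarrow>
    finite_run D p (prefix (n + K) w) (prefix (n + K) (F w t))"
  unfolding beats_def by blast

lemma beats_acc:
  "beats K F p q \<Longrightarrow> w \<in> words Sg \<Longrightarrow> run D q w t \<Longrightarrow> acc t \<Longrightarrow> acc (F w t)"
  unfolding beats_def by blast

lemma beats_run:
  "beats K F p q \<Longrightarrow> w \<in> words Sg \<Longrightarrow> run D q w t \<Longrightarrow> run D p w (F w t)"
  unfolding run_def using beats_legal finite_run_prefix le_add1 by meson

lemma beats_strategy:
  assumes F: "beats K F p q" and R: "strategy D Sg q R"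
  shows "strategy D Sg p (\<lambda>w. F w (R w))"
  unfolding strategy_def
  using causal_delayed[OF beats_delayed[OF F] strategy_causal[OF R]]
    beats_run[OF F _ strategy_run[OF R]]
  by blast

lemma beats_compose:
  assumes F: "beats K F p q" and G: "beats M G q s"
  shows "beats (M + K) (\<lambda>w t. F w (G w t)) p s"
  unfolding beats_def
proof (intro conjI ballI allI impI)
  show "delayed (M + K) (\<lambda>w t. F w (G w t))"
    using delayed_compose F G beats_delayed by blast
next
  fix w t n
  assume "w \<in> words Sg" "finite_run D s (prefix n w) (prefix n t)"
  then show "finite_run D p (prefix (n + (M + K)) w) (prefix (n + (M + K)) (F w (G w t)))"
    using beats_legal[OF F] beats_legal[OF G] by (simp add: add.assoc[symmetric])
next
  fix w t
  assume "w \<in> words Sg" "run D s w t" "acc t"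
  then show "acc (F w (G w t))"
    using beats_acc[OF F] beats_acc[OF G] beats_run[OF G] by blast
qed

lemma beats_antimono:
  assumes "beats K F p q" "M \<le> K"
  shows "beats M F p q"
  unfolding beats_def
proof (intro conjI ballI allI impI)
  show "delayed M F"
    using assms beats_delayed delayed_antimono by blast
next
  fix w t n
  assume "w \<in> words Sg" "finite_run D q (prefix n w) (prefix n t)"
  then have "finite_run D p (prefix (n + K) w) (prefix (n + K) (F w t))"
    by (rule beats_legal[OF assms(1)])
  then show "finite_run D p (prefix (n + M) w) (prefix (n + M) (F w t))"
    using assms(2) by (auto intro: finite_run_prefix)
qed (use assms(1) beats_acc in blast)

lemma dominates_trans: "dominates p q \<Longrightarrow> dominates q s \<Longrightarrow> dominates p s"
  unfolding dominates_def by (meson beats_compose beats_antimono le_add1)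

lemma beats_delay:
  assumes "dominates p p" "dominates p q"
  obtains F where "beats K F p q"
proof -
  have "\<exists>F. beats (Suc K) F p q"
  proof (induction K)
    case (Suc K)
    then show ?case
      using beats_compose[of 1 _ p p "Suc K" _ q] assms(1) by (auto simp: dominates_def)
  qed (use assms(2) in \<open>simp add: dominates_def\<close>)
  then show ?thesis
    using that beats_antimono by (meson le_SucI order_refl)
qed

lemma beats_residual:
  assumes F: "beats K F p q" and ts: "finite_run D q u ts" and u: "set u \<subseteq> Sg"
  shows "beats K (\<lambda>w t. suffix (length u) (F (u \<frown> w) (ts \<frown> t)))
    (target p (prefix (length u) (F (u \<frown> w\<^sub>0) (ts \<frown> t\<^sub>0)))) (target q ts)"
proof -
  have len: "length ts = length u"
    using ts by (rule finite_run_length)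
  have past: "prefix (length u) (F (u \<frown> w) (ts \<frown> t)) = prefix (length u) (F (u \<frown> w\<^sub>0) (ts \<frown> t\<^sub>0))"
    for w t
    using len by (intro delayedD[OF beats_delayed[OF F]]) simp_all
  show ?thesis
    unfolding beats_def
  proof (intro conjI ballI allI impI)
    show "delayed K (\<lambda>w t. suffix (length u) (F (u \<frown> w) (ts \<frown> t)))"
      using delayed_residual[OF beats_delayed[OF F]] len by blast
  next
    fix w t n
    assume w: "w \<in> words Sg" and t: "finite_run D (target q ts) (prefix n w) (prefix n t)"
    let ?f = "F (u \<frown> w) (ts \<frown> t)"
    have "finite_run D q (prefix (length u + n) (u \<frown> w)) (prefix (length u + n) (ts \<frown> t))"
      using ts t len by (simp add: finite_run_append)
    from beats_legal[OF F _ this]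
    have "finite_run D p (u @ prefix (n + K) w)
        (prefix (length u) ?f @ prefix (n + K) (suffix (length u) ?f))"
      using w u by (simp add: subsequence_append[of ?f "length u" "n + K"] add.assoc)
    then show "finite_run D (target p (prefix (length u) (F (u \<frown> w\<^sub>0) (ts \<frown> t\<^sub>0))))
        (prefix (n + K) w) (prefix (n + K) (suffix (length u) ?f))"
      by (subst (asm) finite_run_append) (simp_all add: past[of w t])
  next
    fix w t
    assume "w \<in> words Sg" "run D (target q ts) w t" "acc t"
    then show "acc (suffix (length u) (F (u \<frown> w) (ts \<frown> t)))"
      using beats_acc[OF F, of "u \<frown> w" "ts \<frown> t"] ts u by (simp add: run_conc_iff len)
  qed
qed

lemma dominates_residual:
  assumes "beats 1 F p q" "w \<in> words Sg" "finite_run D q (prefix n w) (prefix n t)"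
  shows "dominates (target p (prefix n (F w t))) (target q (prefix n t))"
  using beats_residual[OF assms(1,3), of "suffix n w" "suffix n t"] assms(2) set_subsequence_words
  unfolding dominates_def by fastforce

lemma beats_move_dominates:
  assumes F: "beats 1 F p q" and w: "w \<in> words Sg"
    and t: "finite_run D q (prefix n w) (prefix n t)"
    and s: "s \<in> D" "src s = target q (prefix n t)" "lbl s = w n"
  shows "dominates (tgt (F w t n)) (tgt s)"
proof -
  let ?t = "t(n := s)"
  have past: "prefix n ?t = prefix n t"
    by (simp add: subsequence_def)
  have "finite_run D q (prefix (Suc n) w) (prefix (Suc n) ?t)"
    using t s by (simp add: finite_run_snoc past)
  from dominates_residual[OF F w this]
  have "dominates (tgt (F w ?t n)) (tgt s)"
    by simp
  moreover have "prefix (Suc n) (F w ?t) = prefix (Suc n) (F w t)"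
    by (rule delayedD[OF beats_delayed[OF F]]) (simp_all only: past diff_Suc_1)
  ultimately show ?thesis
    by simp
qed

lemma dominates_step:
  assumes "dominates p q" "a \<in> Sg"
  shows "\<exists>t\<in>D. src t = p \<and> lbl t = a \<and>
    (\<forall>t'\<in>D. src t' = q \<longrightarrow> lbl t' = a \<longrightarrow> dominates (tgt t) (tgt t'))"
proof -
  obtain F where F: "beats 1 F p q"
    using assms(1) by (auto simp: dominates_def)
  let ?w = "\<lambda>_::nat. a" and ?t = "undefined :: ('s,'a) trans word"
  have w: "?w \<in> words Sg"
    using assms(2) by (auto simp: words_def)
  have "finite_run D p [a] [F ?w ?t 0]"
    using beats_legal[OF F w, of 0] by simp
  then show ?thesis
    using beats_move_dominates[OF F w, of 0] by (auto simp: finite_run_def)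
qed

end

section \<open>Forcing finite blocks of letters\<close>

text \<open>By choosing at most \<open>n\<close> letters Adam makes the list of Eve's moves satisfy \<open>P\<close> at some moment,
  or leaves Eve without a move.\<close>

primrec forces ::
  "('s,'a) trans set \<Rightarrow> 'a set \<Rightarrow> nat \<Rightarrow> (('s,'a) trans list \<Rightarrow> bool) \<Rightarrow> 's \<Rightarrow> bool" where
  "forces D Sg 0 P p \<longleftrightarrow> P []"
| "forces D Sg (Suc n) P p \<longleftrightarrow> P [] \<or>
     (\<exists>a\<in>Sg. \<forall>t\<in>D. src t = p \<longrightarrow> lbl t = a \<longrightarrow> forces D Sg n (\<lambda>h. P (t # h)) (tgt t))"

lemma forces_weaken:
  "forces D Sg n P p \<Longrightarrow> (\<And>h. P h \<Longrightarrow> Q h) \<Longrightarrow> forces D Sg n Q p"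
proof (induction n arbitrary: P Q p)
  case (Suc n)
  have "forces D Sg n (\<lambda>h. P (t # h)) q \<longrightarrow> forces D Sg n (\<lambda>h. Q (t # h)) q" for t q
    using Suc.IH[of "\<lambda>h. P (t # h)" q "\<lambda>h. Q (t # h)"] Suc.prems(2) by blast
  with Suc.prems show ?case
    unfolding forces.simps(2) by blast
qed simp

lemma forces_Suc: "forces D Sg n P p \<Longrightarrow> forces D Sg (Suc n) P p"
proof (induction n arbitrary: P p)
  case (Suc n)
  then show ?case
    unfolding forces.simps(2)[of D Sg "Suc n"] forces.simps(2)[of D Sg n P] by blast
qed simp

lemma forces_mono:
  assumes "forces D Sg n P p" "n \<le> m"
  shows "forces D Sg m P p"
  using assms(2,1) by (induction m rule: dec_induct) (blast intro: forces_Suc)+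

lemma eventually_forces_iff:
  "(\<forall>\<^sub>F n in sequentially. forces D Sg n P p) \<longleftrightarrow> (\<exists>n. forces D Sg n P p)"
  unfolding eventually_sequentially using forces_mono by (metis order_refl)

lemma not_forces_step:
  assumes "finite D" and not_forced: "\<And>n. \<not> forces D Sg n P p" and "a \<in> Sg"
  shows "\<exists>t\<in>D. src t = p \<and> lbl t = a \<and> (\<forall>n. \<not> forces D Sg n (\<lambda>h. P (t # h)) (tgt t))"
proof (rule ccontr)
  assume "\<not> ?thesis"
  then have "\<forall>t\<in>{t \<in> D. src t = p \<and> lbl t = a}.
      \<forall>\<^sub>F n in sequentially. forces D Sg n (\<lambda>h. P (t # h)) (tgt t)"
    unfolding eventually_forces_iff by blast
  then have "\<forall>\<^sub>F n in sequentially. \<forall>t\<in>{t \<in> D. src t = p \<and> lbl t = a}.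
      forces D Sg n (\<lambda>h. P (t # h)) (tgt t)"
    using assms(1) by (intro eventually_ball_finite) auto
  then obtain n where "\<forall>t\<in>{t \<in> D. src t = p \<and> lbl t = a}. forces D Sg n (\<lambda>h. P (t # h)) (tgt t)"
    by (auto simp: eventually_sequentially)
  then have "forces D Sg (Suc n) P p"
    using assms(3) unfolding forces.simps(2) by blast
  with not_forced show False
    by blast
qed

lemma avoiding_strategy:
  assumes "finite D" "\<And>n. \<not> forces D Sg n P p"
  shows "\<exists>R. strategy D Sg p R \<and> (\<forall>w\<in>words Sg. \<forall>n. \<not> P (prefix n (R w)))"
proof -
  define Inv where "Inv h \<longleftrightarrow> (\<forall>n. \<not> forces D Sg n (\<lambda>h'. P (h @ h')) (target p h))" for h
  have step: "\<exists>t\<in>D. src t = target p h \<and> lbl t = a \<and> Inv (h @ [t])" if "Inv h" "a \<in> Sg" for h a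
    using not_forces_step[OF assms(1) _ that(2), of "\<lambda>h'. P (h @ h')" "target p h"] that(1)
    by (simp add: Inv_def)
  have "Inv []"
    using assms(2) by (simp add: Inv_def)
  then obtain R where R: "strategy D Sg p R" "\<And>w n. w \<in> words Sg \<Longrightarrow> Inv (prefix n (R w))"
    using history_strategy[of Inv Sg D p] step by metis
  have "\<not> P h" if "Inv h" for h
    using that[unfolded Inv_def, rule_format, of 0] by simp
  with R show ?thesis
    by blast
qed

lemma causal_first_move:
  assumes R: "causal R" and a: "a \<in> Sg" and w: "w \<in> words Sg"
    and legal: "\<And>w. w \<in> words Sg \<Longrightarrow>
      finite_run D p (prefix (Suc n) w) (prefix (Suc n) (R w))"
    and t: "t = R (\<lambda>_. a) 0"
  shows "t \<in> D" "src t = p" "lbl t = a"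
    "finite_run D (tgt t) (prefix n w) (prefix n (suffix 1 (R ([a] \<frown> w))))"
proof -
  have "[a] \<frown> w \<in> words Sg"
    using a w by (simp del: build_cons)
  moreover have "prefix (Suc n) ([a] \<frown> w) = a # prefix n w"
    by (subst prefix_conc_snd) simp_all
  ultimately have "finite_run D p (a # prefix n w) (t # prefix n (suffix 1 (R ([a] \<frown> w))))"
    using legal[of "[a] \<frown> w"] by (simp only: causal_first_letter[OF R] t)
  then show "t \<in> D" "src t = p" "lbl t = a"
    "finite_run D (tgt t) (prefix n w) (prefix n (suffix 1 (R ([a] \<frown> w))))"
    by (auto simp: finite_run_def)
qed

lemma forces_outcome:
  assumes "Sg \<noteq> {}" and "forces D Sg n P p" and "causal R"
    and "\<And>w. w \<in> words Sg \<Longrightarrow> finite_run D p (prefix n w) (prefix n (R w))"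
  shows "\<exists>w\<in>words Sg. \<exists>m\<le>n. P (prefix m (R w))"
proof -
  obtain v where v: "v \<in> words Sg"
    using assms(1) words_eq_empty_iff by blast
  show ?thesis
    using assms(2-)
  proof (induction n arbitrary: P p R)
    case 0
    then show ?case
      using v by auto
  next
    case (Suc n)
    show ?case
    proof (cases "P []")
      case True
      then have "P (prefix 0 (R v))"
        by simp
      with v show ?thesis
        by blast
    next
      case False
      then obtain a where a: "a \<in> Sg" and
        forced: "\<And>t. t \<in> D \<Longrightarrow> src t = p \<Longrightarrow> lbl t = a \<Longrightarrow> forces D Sg n (\<lambda>h. P (t # h)) (tgt t)"
        using Suc.prems(1) by auto
      note move = causal_first_move[OF Suc.prems(2) a _ Suc.prems(3) refl]
      have "causal (\<lambda>w. suffix 1 (R ([a] \<frown> w)))"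
        using causal_residual[OF Suc.prems(2), of "[a]"] by simp
      from Suc.IH[OF forced[OF move(1-3)[OF v]] this move(4)]
      obtain w m where w: "w \<in> words Sg" "m \<le> n"
        "P (R (\<lambda>_. a) 0 # prefix m (suffix 1 (R ([a] \<frown> w))))"
        by blast
      then have "P (prefix (Suc m) (R ([a] \<frown> w)))"
        by (simp only: causal_first_letter[OF Suc.prems(2)])
      moreover have "[a] \<frown> w \<in> words Sg"
        using a w(1) by (simp del: build_cons)
      ultimately show ?thesis
        using w(2) Suc_le_mono by blast
    qed
  qed
qed

context token_game
begin

lemma beats_not_forces:
  assumes "Sg \<noteq> {}" "beats n F p q"
  shows "\<not> forces D Sg n (\<lambda>_. False) p"
proof
  assume forced: "forces D Sg n (\<lambda>_. False) p"
  have "causal (\<lambda>w. F w undefined)"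
    by (rule causal_delayed[OF beats_delayed[OF assms(2)] causal_const])
  moreover have "finite_run D p (prefix n w) (prefix n (F w undefined))" if "w \<in> words Sg" for w
    using beats_legal[OF assms(2) that, of 0 undefined] by simp
  ultimately show False
    using forces_outcome[OF assms(1) forced] by blast
qed

definition reply ::
  "('a word \<Rightarrow> ('s,'a) trans word \<Rightarrow> ('s,'a) trans word) \<Rightarrow>
    ('s,'a) trans list \<Rightarrow> ('s,'a) trans list" where
  "reply F xs = prefix (length xs) (F (map lbl xs \<frown> undefined) (xs \<frown> undefined))"

lemma reply_eq:
  "delayed K F \<Longrightarrow> prefix (length xs) w = map lbl xs \<Longrightarrow>
    prefix (length xs - K) t = take (length xs - K) xs \<Longrightarrow> reply F xs = prefix (length xs) (F w t)"
  unfolding reply_def by (rule delayedD[of K]) simp_all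

lemma reply_finite_run:
  assumes "Sg \<noteq> {}" "beats K F p q" "path D q xs" "lbl ` set xs \<subseteq> Sg"
  shows "finite_run D p (map lbl xs) (reply F xs)"
proof -
  obtain w where w: "w \<in> words Sg"
    using assms(1) words_eq_empty_iff by blast
  have "finite_run D p (prefix (length xs + K) (map lbl xs \<frown> w))
      (prefix (length xs + K) (F (map lbl xs \<frown> w) (xs \<frown> undefined)))"
    by (rule beats_legal[OF assms(2)]) (use w assms(3,4) in \<open>simp_all add: finite_run_def\<close>)
  from finite_run_prefix[OF this, of "length xs"] show ?thesis
    using reply_eq[OF beats_delayed[OF assms(2)], of "map lbl xs \<frown> w" xs "xs \<frown> undefined"] by simp
qed

text \<open>Eve's moves in the next \<open>K\<close> rounds do not depend on the token, so Adam may choose the whole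
  block of letters first and move the token afterwards.\<close>

lemma forced_reply:
  assumes "Sg \<noteq> {}" and F: "beats K F p q" and xs: "path D q xs" "lbl ` set xs \<subseteq> Sg"
    and forced: "forces D Sg K P (target p (reply F xs))"
  obtains h where "P h" "lbl ` set h \<subseteq> Sg"
    "\<And>ys. map lbl ys = map lbl h \<Longrightarrow> reply F (xs @ ys) = reply F xs @ h"
proof -
  let ?u = "map lbl xs"
  define G where "G = (\<lambda>w t. suffix (length ?u) (F (?u \<frown> w) (xs \<frown> t)))"
  have "finite_run D q ?u xs"
    using xs by (simp add: finite_run_def)
  from beats_residual[OF F this, of undefined undefined] xs(2)
  have G: "beats K G (target p (reply F xs)) (target q xs)"
    by (simp add: G_def reply_def)
  have "causal (\<lambda>w. G w undefined)"
    by (rule causal_delayed[OF beats_delayed[OF G] causal_const])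
  moreover have legal:
    "finite_run D (target p (reply F xs)) (prefix K w) (prefix K (G w undefined))"
    if "w \<in> words Sg" for w
    using beats_legal[OF G that, of 0 undefined] by simp
  ultimately obtain w m where w: "w \<in> words Sg" and m: "m \<le> K" "P (prefix m (G w undefined))"
    using forces_outcome[OF assms(1) forced] by blast
  define h where "h = prefix m (G w undefined)"
  have h: "map lbl h = prefix m w"
    using finite_run_prefix[OF legal[OF w] m(1)] by (simp add: h_def finite_run_def)
  have "reply F (xs @ ys) = reply F xs @ h" if "map lbl ys = map lbl h" for ys
  proof -
    have "length ys = m"
      using arg_cong[OF that, of length] by (simp add: h_def)
    then have "reply F (xs @ ys) = prefix (length xs + m) (F (?u \<frown> w) (xs \<frown> undefined))"
      using reply_eq[OF beats_delayed[OF F], of "?u \<frown> w" "xs @ ys" "xs \<frown> undefined"] that h m(1)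
      by simp
    also have "\<dots> = reply F xs @ h"
      using subsequence_append[of "F (?u \<frown> w) (xs \<frown> undefined)" "length xs" m]
        reply_eq[OF beats_delayed[OF F], of "?u \<frown> w" xs "xs \<frown> undefined"]
      by (simp add: h_def G_def)
    finally show ?thesis .
  qed
  moreover have "lbl ` set h \<subseteq> Sg"
    using arg_cong[OF h, of set] set_subsequence_words[OF w] by auto
  ultimately show ?thesis
    using that m(2) by (simp add: h_def)
qed

end

section \<open>Arenas of mutually dominating states\<close>

locale arena = token_game D Sg acc + finite_graph D Sg V
  for D :: "('s,'a) trans set" and Sg :: "'a set" and acc :: "('s,'a) trans word \<Rightarrow> bool"
    and V :: "'s set" +
  fixes cls :: "'s \<Rightarrow> 'k"
  assumes total: "p \<in> V \<Longrightarrow> a \<in> Sg \<Longrightarrow> \<exists>t\<in>D. src t = p \<and> lbl t = a"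
    and cls_step: "t \<in> D \<Longrightarrow> t' \<in> D \<Longrightarrow> lbl t = lbl t' \<Longrightarrow> cls (src t) = cls (src t') \<Longrightarrow>
      cls (tgt t) = cls (tgt t')"
    and cls_dominates: "p \<in> V \<Longrightarrow> q \<in> V \<Longrightarrow> cls p = cls q \<Longrightarrow> dominates p q"
begin

lemma ex_finite_run:
  "p \<in> V \<Longrightarrow> set u \<subseteq> Sg \<Longrightarrow> \<exists>ts. finite_run D p u ts"
proof (induction u arbitrary: p)
  case (Cons a u)
  then have a: "a \<in> Sg" and u: "set u \<subseteq> Sg"
    by simp_all
  obtain t where t: "t \<in> D" "src t = p" "lbl t = a"
    using total[OF Cons.prems(1) a] by blast
  then obtain ts where "finite_run D (tgt t) u ts"
    using Cons.IH u transD by blast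
  with t have "finite_run D p (a # u) (t # ts)"
    by (simp add: finite_run_def)
  then show ?case ..
qed (auto intro: exI[of _ "[]"])

lemma finite_run_cls:
  "finite_run D p u ts \<Longrightarrow> finite_run D q u ts' \<Longrightarrow> cls p = cls q \<Longrightarrow>
    cls (target p ts) = cls (target q ts')"
proof (induction u arbitrary: p q ts ts')
  case (Cons a u)
  then obtain t s t' s' where "ts = t # s" "ts' = t' # s'"
    by (auto simp: finite_run_def)
  then show ?case
    using Cons.IH[of "tgt t" s "tgt t'" s'] Cons.prems cls_step[of t t']
    by (auto simp: finite_run_def)
qed (auto simp: finite_run_def)

lemma default_strategy:
  assumes "p \<in> V"
  shows "\<exists>R. strategy D Sg p R"
proof -
  have "target p [] \<in> V"
    using assms by simp
  moreover have "\<exists>t\<in>D. src t = target p h \<and> lbl t = a \<and> target p (h @ [t]) \<in> V"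
    if "target p h \<in> V" "a \<in> Sg" for h a
    using total[OF that] transD by auto
  ultimately show ?thesis
    using history_strategy[of "\<lambda>h. target p h \<in> V"] by blast
qed

definition block ::
  "('s \<Rightarrow> 's \<Rightarrow> bool) \<Rightarrow> (('s,'a) trans list \<Rightarrow> ('s,'a) trans list \<Rightarrow> bool) \<Rightarrow>
    's \<Rightarrow> 's \<Rightarrow> ('s,'a) trans list \<Rightarrow> bool" where
  "block \<Psi> Q p x h \<longleftrightarrow> h \<noteq> [] \<and>
     (\<exists>xs. finite_run D x (map lbl h) xs \<and> \<Psi> (target p h) (target x xs) \<and> Q h xs)"

lemma block_extension:
  assumes F: "beats K F p x" and V: "p \<in> V" "x \<in> V" "cls p = cls x"
    and xs: "path D x xs" "\<Psi> (target p (reply F xs)) (target x xs)"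
    and forced: "\<And>p x. p \<in> V \<Longrightarrow> x \<in> V \<Longrightarrow> cls p = cls x \<Longrightarrow> \<Psi> p x \<Longrightarrow>
      forces D Sg K (block \<Psi> Q p x) p"
  shows "\<exists>ys. ys \<noteq> [] \<and> path D x (xs @ ys) \<and> \<Psi> (target p (reply F (xs @ ys))) (target x (xs @ ys)) \<and>
    Q (drop (length xs) (reply F (xs @ ys))) ys"
proof -
  let ?p = "target p (reply F xs)" and ?x = "target x xs"
  have reply: "finite_run D p (map lbl xs) (reply F xs)"
    using reply_finite_run[OF Sg_nonempty F xs(1)] path_labels[OF xs(1)] by blast
  moreover have "finite_run D x (map lbl xs) xs"
    using xs(1) by (simp add: finite_run_def)
  ultimately have "cls ?p = cls ?x"
    using V(3) by (rule finite_run_cls)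
  moreover have "?p \<in> V" "?x \<in> V"
    using reply xs(1) V target_in_V by (auto simp: finite_run_def)
  ultimately have "forces D Sg K (block \<Psi> Q ?p ?x) ?p"
    using forced xs(2) by blast
  from forced_reply[OF Sg_nonempty F xs(1) path_labels[OF xs(1)] this] obtain h
    where h: "block \<Psi> Q ?p ?x h"
      "\<And>ys. map lbl ys = map lbl h \<Longrightarrow> reply F (xs @ ys) = reply F xs @ h"
    by metis
  obtain ys where ys: "finite_run D ?x (map lbl h) ys" "\<Psi> (target ?p h) (target ?x ys)"
    "Q h ys" "h \<noteq> []"
    using h(1) by (auto simp: block_def)
  then have "reply F (xs @ ys) = reply F xs @ h"
    by (intro h(2)) (simp add: finite_run_def)
  moreover have "length (reply F xs) = length xs" "length ys = length h"
    using finite_run_length[OF ys(1)] by (simp_all add: reply_def)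
  ultimately show ?thesis
    using ys xs(1) by (intro exI[of _ ys]) (auto simp: finite_run_def)
qed

lemma uniform_block_length:
  assumes "finite I" and forced: "\<And>p x i. p \<in> V \<Longrightarrow> x \<in> V \<Longrightarrow> cls p = cls x \<Longrightarrow> \<Psi> p x \<Longrightarrow> i \<in> I \<Longrightarrow>
    \<exists>n. forces D Sg n (block \<Psi> (Q i) p x) p"
  shows "\<exists>K. \<forall>p\<in>V. \<forall>x\<in>V. \<forall>i\<in>I. cls p = cls x \<longrightarrow> \<Psi> p x \<longrightarrow>
    forces D Sg K (block \<Psi> (Q i) p x) p"
proof -
  define S where "S = {(p, x, i) \<in> V \<times> V \<times> I. cls p = cls x \<and> \<Psi> p x}"
  have "finite S"
    using finite_V assms(1) by (auto simp: S_def intro: finite_subset[of _ "V \<times> V \<times> I"])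
  moreover have "\<forall>(p, x, i)\<in>S. \<forall>\<^sub>F n in sequentially. forces D Sg n (block \<Psi> (Q i) p x) p"
    using forced by (auto simp: S_def eventually_forces_iff)
  ultimately have "\<forall>\<^sub>F n in sequentially. \<forall>(p, x, i)\<in>S. forces D Sg n (block \<Psi> (Q i) p x) p"
    unfolding case_prod_beta by (rule eventually_ball_finite)
  then obtain K where "\<forall>(p, x, i)\<in>S. forces D Sg K (block \<Psi> (Q i) p x) p"
    by (auto simp: eventually_sequentially)
  then show ?thesis
    by (auto simp: S_def)
qed

lemma block_sequence:
  assumes F: "beats K F p x" and V: "p \<in> V" "x \<in> V" "cls p = cls x" and "\<Psi> p x"
    and forced: "\<And>p x k. p \<in> V \<Longrightarrow> x \<in> V \<Longrightarrow> cls p = cls x \<Longrightarrow> \<Psi> p x \<Longrightarrow>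
      forces D Sg K (block \<Psi> (Q k) p x) p"
  obtains f where "f 0 = []" "\<And>k. path D x (f k)"
    "\<And>k::nat. \<exists>ys. ys \<noteq> [] \<and> f (Suc k) = f k @ ys \<and>
      Q k (drop (length (f k)) (reply F (f (Suc k)))) ys"
proof -
  define good where "good k xs \<longleftrightarrow> path D x xs \<and> \<Psi> (target p (reply F xs)) (target x xs) \<and>
    (k = 0 \<longrightarrow> xs = [])" for k :: nat and xs
  define next_block where "next_block k xs xs' \<longleftrightarrow>
    (\<exists>ys. ys \<noteq> [] \<and> xs' = xs @ ys \<and> Q k (drop (length xs) (reply F xs')) ys)" for k xs xs'
  have "\<exists>f. \<forall>k. good k (f k) \<and> next_block k (f k) (f (Suc k))"
  proof (rule dependent_nat_choice)
    show "\<exists>xs. good 0 xs"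
      using \<open>\<Psi> p x\<close> by (auto simp: good_def reply_def)
  next
    fix xs k
    assume "good k xs"
    then have "path D x xs" "\<Psi> (target p (reply F xs)) (target x xs)"
      by (simp_all add: good_def)
    from block_extension[where \<Psi> = \<Psi> and Q = "Q k", OF F V this forced]
    obtain ys where "ys \<noteq> []" "path D x (xs @ ys)"
      "\<Psi> (target p (reply F (xs @ ys))) (target x (xs @ ys))"
      "Q k (drop (length xs) (reply F (xs @ ys))) ys"
      by blast
    then show "\<exists>xs'. good (Suc k) xs' \<and> next_block k xs xs'"
      by (intro exI[of _ "xs @ ys"]) (auto simp: good_def next_block_def)
  qed
  then obtain f where f: "\<And>k. good k (f k)" "\<And>k. next_block k (f k) (f (Suc k))"
    by blast
  show ?thesis
    by (rule that[of f]) (use f(1)[of 0] f in \<open>simp_all add: good_def next_block_def\<close>)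
qed

lemma forced_blocks:
  fixes e :: "'i word"
  assumes V: "p \<in> V" "x \<in> V" "cls p = cls x" and "\<Psi> p x" and "finite (range e)"
    and forced: "\<And>p x i. p \<in> V \<Longrightarrow> x \<in> V \<Longrightarrow> cls p = cls x \<Longrightarrow> \<Psi> p x \<Longrightarrow> i \<in> range e \<Longrightarrow>
      \<exists>n. forces D Sg n (block \<Psi> (Q i) p x) p"
  shows "\<exists>r t T. (acc t \<longrightarrow> acc r) \<and> idx_sequence T \<and>
    (\<forall>k. Q (e k) (r [T k \<rightarrow> T (Suc k)]) (t [T k \<rightarrow> T (Suc k)]))"
proof -
  obtain K where K: "\<And>p x i. p \<in> V \<Longrightarrow> x \<in> V \<Longrightarrow> cls p = cls x \<Longrightarrow> \<Psi> p x \<Longrightarrow> i \<in> range e \<Longrightarrow>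
      forces D Sg K (block \<Psi> (Q i) p x) p"
    using uniform_block_length[of "range e" \<Psi> Q, OF assms(5) forced] by blast
  obtain F where F: "beats K F p x"
    using beats_delay[OF cls_dominates[OF V(1,1) refl] cls_dominates[OF V]] .
  obtain f where f: "f 0 = []" "\<And>k. path D x (f k)"
    "\<And>k. \<exists>ys. ys \<noteq> [] \<and> f (Suc k) = f k @ ys \<and>
      Q (e k) (drop (length (f k)) (reply F (f (Suc k)))) ys"
    using block_sequence[where \<Psi> = \<Psi> and Q = "\<lambda>k. Q (e k)", OF F V \<open>\<Psi> p x\<close> K] by blast
  define T where "T k = length (f k)" for k
  obtain t where t: "\<And>k. prefix (T k) t = f k" and T: "idx_sequence T"
    using increasing_lists_limit[of f] f(1,3) unfolding T_def by blast
  let ?w = "lbl \<circ> t"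
  have run: "run D x ?w t"
    using f(2) by (intro run_limit[OF T]) (simp add: t)
  then have "?w \<in> words Sg"
    using transD by (simp add: words_def run_iff image_subset_iff)
  then have "acc t \<longrightarrow> acc (F ?w t)"
    using beats_acc[OF F] run by blast
  moreover have "Q (e k) ((F ?w t) [T k \<rightarrow> T (Suc k)]) (t [T k \<rightarrow> T (Suc k)])" for k
  proof -
    have "prefix n ?w = map lbl (prefix n t)" for n
      by (simp add: subsequence_def)
    then have "reply F (prefix n t) = prefix n (F ?w t)" for n
      using reply_eq[OF beats_delayed[OF F], of ?w "prefix n t" t] by simp
    from this[of "T (Suc k)"] have "reply F (f (Suc k)) = prefix (T (Suc k)) (F ?w t)"
      by (simp only: t)
    moreover have "drop (T k) (f (Suc k)) = t [T k \<rightarrow> T (Suc k)]"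
      using arg_cong[OF t[of "Suc k"], of "drop (T k)"] by simp
    ultimately show ?thesis
      using f(3)[of k] by (auto simp: T_def)
  qed
  ultimately show ?thesis
    using T by blast
qed

end

section \<open>Generalised Buchi acceptance\<close>

locale buchi_arena = arena D Sg acc V cls
  for D :: "('s,'a) trans set" and Sg :: "'a set" and acc :: "('s,'a) trans word \<Rightarrow> bool"
    and V :: "'s set" and cls :: "'s \<Rightarrow> 'k" +
  fixes co :: "('s,'a) trans \<Rightarrow> 'c set" and C :: "'c set"
  assumes acc_iff: "acc r \<longleftrightarrow> gen_buchi C (\<lambda>i. co (r i))" and finite_C: "finite C"
begin

definition event :: "'s \<Rightarrow> 'a list \<Rightarrow> bool" where
  "event p u \<longleftrightarrow> (\<forall>q\<in>V. cls q = cls p \<longrightarrow> (\<exists>xs. finite_run D q u xs \<and> C \<subseteq> \<Union>(co ` set xs)))"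

definition missed_event :: "'c \<Rightarrow> 's set \<Rightarrow> 's \<Rightarrow> ('s,'a) trans list \<Rightarrow> bool" where
  "missed_event c Z p h \<longleftrightarrow>
     h \<noteq> [] \<and> (\<forall>t\<in>set h. c \<notin> co t) \<and> event p (map lbl h) \<and> target p h \<notin> Z"

text \<open>From \<open>within c N\<close> Eve sees \<open>c\<close> before the \<open>N\<close>-th event.\<close>

primrec within :: "'c \<Rightarrow> nat \<Rightarrow> 's set" where
  "within c 0 = {}"
| "within c (Suc N) = {p \<in> V. \<forall>n. \<not> forces D Sg n (missed_event c (within c N) p) p}"

lemma within_subset: "within c N \<subseteq> V"
  by (cases N) auto

lemma missed_event_antimono: "Z \<subseteq> Z' \<Longrightarrow> missed_event c Z' p h \<Longrightarrow> missed_event c Z p h"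
  by (auto simp: missed_event_def)

lemma within_mono: "N \<le> M \<Longrightarrow> within c N \<subseteq> within c M"
proof (rule lift_Suc_mono_le)
  have within_Suc_iff: "p \<in> within c (Suc N) \<longleftrightarrow>
      p \<in> V \<and> (\<forall>n. \<not> forces D Sg n (missed_event c (within c N) p) p)" for p N
    by simp
  show "within c N \<subseteq> within c (Suc N)" for N
  proof (induction N)
    case (Suc N)
    have "forces D Sg n (missed_event c (within c N) p) p"
      if "forces D Sg n (missed_event c (within c (Suc N)) p) p" for n p
      using that missed_event_antimono[OF Suc] by (rule forces_weaken)
    then show ?case
      unfolding subset_eq Ball_def within_Suc_iff by blast
  qed simp
qed

lemma within_stabilises: "\<exists>N. \<forall>M. within c M \<subseteq> within c N"
proof -
  have "finite (\<Union>N. within c N)"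
    using finite_V within_subset by (auto intro: finite_subset)
  moreover have "\<forall>\<^sub>F N in sequentially. p \<in> within c N" if "p \<in> (\<Union>N. within c N)" for p
    using that within_mono unfolding eventually_sequentially by (metis UN_E subsetD)
  ultimately have "\<forall>\<^sub>F N in sequentially. \<forall>p\<in>\<Union>N. within c N. p \<in> within c N"
    by (intro eventually_ball_finite) blast+
  then show ?thesis
    by (auto simp: eventually_sequentially)
qed

lemma outside_within_forces:
  assumes N: "\<And>M. within c M \<subseteq> within c N" and "p \<in> V" "x \<in> V" "cls p = cls x" "p \<notin> within c N"
  shows "\<exists>n. forces D Sg n (block (\<lambda>p x. p \<notin> within c N)
    (\<lambda>h xs. (\<forall>t\<in>set h. c \<notin> co t) \<and> C \<subseteq> \<Union>(co ` set xs)) p x) p"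
proof -
  have "p \<notin> within c (Suc N)"
    using assms(5) N by blast
  then obtain n where "forces D Sg n (missed_event c (within c N) p) p"
    using assms(2) by auto
  then have "forces D Sg n (block (\<lambda>p x. p \<notin> within c N)
      (\<lambda>h xs. (\<forall>t\<in>set h. c \<notin> co t) \<and> C \<subseteq> \<Union>(co ` set xs)) p x) p"
    by (rule forces_weaken) (use assms(3,4) in \<open>auto simp: missed_event_def event_def block_def\<close>)
  then show ?thesis ..
qed

lemma within_exhausts:
  assumes p: "p \<in> V" and c: "c \<in> C"
  shows "\<exists>N. p \<in> within c N"
proof (rule ccontr)
  assume outside: "\<not> ?thesis"
  obtain N where N: "\<And>M. within c M \<subseteq> within c N"
    using within_stabilises by blast
  define Q where "Q h xs \<longleftrightarrow> (\<forall>t\<in>set h. c \<notin> co t) \<and> C \<subseteq> \<Union>(co ` set xs)" for h xs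
  have forced: "\<exists>n. forces D Sg n (block (\<lambda>q x. q \<notin> within c N) Q q x) q"
    if "q \<in> V" "x \<in> V" "cls q = cls x" "q \<notin> within c N" for q x
    unfolding Q_def[abs_def] by (rule outside_within_forces[OF N that])
  have "p \<notin> within c N" "finite (range (\<lambda>_::nat. ()))"
    using outside by simp_all
  from forced_blocks[where \<Psi> = "\<lambda>q x. q \<notin> within c N" and Q = "\<lambda>_. Q",
      OF p p refl this forced]
  obtain r t T where r: "acc t \<longrightarrow> acc r" and T: "idx_sequence T"
    and blocks: "\<And>k. Q (r [T k \<rightarrow> T (Suc k)]) (t [T k \<rightarrow> T (Suc k)])"
    by blast
  have "\<exists>\<^sub>\<infinity>i. d \<in> co (t i)" if "d \<in> C" for d
    using T
  proof (rule idx_sequence_INFM[where P = "\<lambda>y. d \<in> co y"])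
    have "\<exists>y\<in>set (t [T k \<rightarrow> T (Suc k)]). d \<in> co y" for k
      using blocks[of k] that by (fastforce simp: Q_def)
    then show "\<exists>\<^sub>\<infinity>k. \<exists>y\<in>set (t [T k \<rightarrow> T (Suc k)]). d \<in> co y"
      by (auto simp: INFM_nat_le)
  qed
  with r c have "\<exists>\<^sub>\<infinity>i. c \<in> co (r i)"
    by (simp add: acc_iff gen_buchi_def)
  moreover have "c \<notin> co (r i)" for i
    using T by (rule idx_sequence_all[where P = "\<lambda>y. c \<notin> co y"]) (use blocks in \<open>auto simp: Q_def\<close>)
  ultimately show False
    by simp
qed

lemma event_eventually:
  assumes q: "q \<in> V" "cls q = cls p" and w: "w \<in> words Sg" and r: "run D q w r" "acc r"
  shows "\<forall>\<^sub>F n in sequentially. event p (prefix n w)"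
proof -
  have "\<forall>\<^sub>F n in sequentially. \<exists>xs. finite_run D y (prefix n w) xs \<and> C \<subseteq> \<Union>(co ` set xs)"
    if y: "y \<in> V" "cls y = cls p" for y
  proof -
    obtain F where F: "beats 1 F y q"
      using cls_dominates[of y q] y q unfolding dominates_def by auto
    have "\<forall>\<^sub>F n in sequentially. d \<in> \<Union>(co ` set (prefix n (F w r)))" if "d \<in> C" for d
    proof -
      have "\<exists>\<^sub>\<infinity>i. d \<in> co (F w r i)"
        using beats_acc[OF F w r] that by (simp add: acc_iff gen_buchi_def)
      then obtain i where "d \<in> co (F w r i)"
        by (blast dest: INFM_EX)
      then show ?thesis
        by (intro eventually_sequentiallyI[of "Suc i"]) auto
    qed
    then have "\<forall>\<^sub>F n in sequentially. C \<subseteq> \<Union>(co ` set (prefix n (F w r)))"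
      unfolding subset_eq using finite_C by (intro eventually_ball_finite) auto
    then show ?thesis
      by (rule eventually_mono) (use run_finite_run[OF beats_run[OF F w r(1)]] in blast)
  qed
  then have "\<forall>\<^sub>F n in sequentially. \<forall>y\<in>{y \<in> V. cls y = cls p}.
      \<exists>xs. finite_run D y (prefix n w) xs \<and> C \<subseteq> \<Union>(co ` set xs)"
    using finite_V by (intro eventually_ball_finite) auto
  then show ?thesis
    by (rule eventually_mono) (auto simp: event_def)
qed

end

datatype ('s, 'a) phase =
  Phase (goal: nat) (budget: nat) (origin: 's) (trail: "('s, 'a) trans list")

context buchi_arena
begin

text \<open>In a phase Eve looks for the colour \<open>e (goal m)\<close>. A phase ends when this colour or an event
  is seen, and the budget is the number of events by which the colour is seen.\<close>

definition start :: "'c word \<Rightarrow> nat \<Rightarrow> 's \<Rightarrow> ('s, 'a) phase" where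
  "start e j p = Phase j (LEAST N. p \<in> within (e j) N) p []"

definition hit :: "'c word \<Rightarrow> ('s, 'a) phase \<Rightarrow> ('s, 'a) trans \<Rightarrow> bool" where
  "hit e m t \<longleftrightarrow> e (goal m) \<in> co t"

definition completes_event :: "('s, 'a) phase \<Rightarrow> ('s, 'a) trans \<Rightarrow> bool" where
  "completes_event m t \<longleftrightarrow> event (origin m) (map lbl (trail m @ [t]))"

definition advance :: "'c word \<Rightarrow> ('s, 'a) phase \<Rightarrow> ('s, 'a) trans \<Rightarrow> ('s, 'a) phase" where
  "advance e m t =
     (if hit e m t then start e (Suc (goal m)) (tgt t)
      else if completes_event m t then Phase (goal m) (budget m - 1) (tgt t) []
      else Phase (goal m) (budget m) (origin m) (trail m @ [t]))"

definition phase_after :: "'c word \<Rightarrow> 's \<Rightarrow> ('s, 'a) trans list \<Rightarrow> ('s, 'a) phase" where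
  "phase_after e p h = foldl (advance e) (start e 0 p) h"

definition viable :: "'c word \<Rightarrow> ('s, 'a) phase \<Rightarrow> bool" where
  "viable e m \<longleftrightarrow> (let c = e (goal m) in
     origin m \<in> within c (budget m) \<and> (\<forall>t\<in>set (trail m). c \<notin> co t) \<and>
     (\<forall>n. \<not> forces D Sg n (\<lambda>h. missed_event c (within c (budget m - 1)) (origin m) (trail m @ h))
        (target (origin m) (trail m))))"

lemma viable_fresh: "p \<in> within (e j) N \<Longrightarrow> viable e (Phase j N p [])"
  by (cases N) (auto simp: viable_def)

lemma viable_start: "p \<in> V \<Longrightarrow> e j \<in> C \<Longrightarrow> viable e (start e j p)"
  unfolding start_def by (rule viable_fresh, rule LeastI_ex, rule within_exhausts)

lemma viable_budget_pos: "viable e m \<Longrightarrow> budget m > 0"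
  by (rule ccontr) (simp add: viable_def)

lemma viable_advance:
  assumes e: "\<And>j. e j \<in> C" and m: "viable e m" and a: "a \<in> Sg"
  shows "\<exists>t\<in>D. src t = target (origin m) (trail m) \<and> lbl t = a \<and> viable e (advance e m t)"
proof -
  let ?c = "e (goal m)"
  obtain t where t: "t \<in> D" "src t = target (origin m) (trail m)" "lbl t = a"
    and unforced: "\<And>n. \<not> forces D Sg n
      (\<lambda>h. missed_event ?c (within ?c (budget m - 1)) (origin m) (trail m @ t # h)) (tgt t)"
    using not_forces_step[OF finite_D _ a, of _ "target (origin m) (trail m)"] m
    unfolding viable_def Let_def by meson
  have "viable e (advance e m t)"
  proof (cases "hit e m t \<or> completes_event m t")
    case True
    show ?thesis
    proof (cases "hit e m t")
      case True
      then show ?thesis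
        using viable_start transD[OF t(1)] e by (simp add: advance_def)
    next
      case False
      have "\<not> missed_event ?c (within ?c (budget m - 1)) (origin m) (trail m @ [t])"
        using unforced[of 0] by simp
      then have "tgt t \<in> within ?c (budget m - 1)"
        using True False m
        by (auto simp: missed_event_def viable_def hit_def completes_event_def Let_def)
      then show ?thesis
        using True False viable_fresh by (simp add: advance_def)
    qed
  next
    case False
    then show ?thesis
      using m unforced by (auto simp: advance_def viable_def hit_def Let_def)
  qed
  with t show ?thesis
    by blast
qed

lemma phase_after_Nil [simp]: "phase_after e p [] = start e 0 p"
  by (simp add: phase_after_def)

lemma phase_after_snoc [simp]: "phase_after e p (h @ [t]) = advance e (phase_after e p h) t"
  by (simp add: phase_after_def)

lemma phase_after_split:
  "\<exists>xs. h = xs @ trail (phase_after e p h) \<and> origin (phase_after e p h) = target p xs"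
proof (induction h rule: rev_induct)
  case (snoc t h)
  then show ?case
    by (force simp: advance_def start_def)
qed (simp add: start_def)

lemma phase_after_target:
  "target (origin (phase_after e p h)) (trail (phase_after e p h)) = target p h"
  using phase_after_split[of h e p] by (metis target_simps(3))

lemma chasing_strategy:
  assumes "p \<in> V" and e: "\<And>j. e j \<in> C"
  shows "\<exists>R. strategy D Sg p R \<and> (\<forall>w\<in>words Sg. \<forall>n. viable e (phase_after e p (prefix n (R w))))"
proof (rule history_strategy)
  show "viable e (phase_after e p [])"
    using assms by (simp add: viable_start)
  show "\<exists>t\<in>D. src t = target p h \<and> lbl t = a \<and> viable e (phase_after e p (h @ [t]))"
    if "viable e (phase_after e p h)" "a \<in> Sg" for h a
    using viable_advance[OF e that] by (simp add: phase_after_target)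
qed

context
  fixes e :: "'c word" and p :: 's and w :: "'a word" and r s :: "('s,'a) trans word"
  assumes p: "p \<in> V" and w: "w \<in> words Sg" and r: "run D p w r" and s: "run D p w s" "acc s"
    and viable: "\<And>k. viable e (phase_after e p (prefix k r))"
begin

abbreviation phase_at :: "nat \<Rightarrow> ('s,'a) phase" where
  "phase_at k \<equiv> phase_after e p (prefix k r)"

lemma phase_ends: "\<exists>k\<ge>i. hit e (phase_at k) (r k) \<or> completes_event (phase_at k) (r k)"
proof (rule ccontr)
  assume no_end: "\<not> ?thesis"
  obtain xs where xs: "prefix i r = xs @ trail (phase_at i)" "origin (phase_at i) = target p xs"
    using phase_after_split by blast
  define k where "k = length xs"
  have k: "k \<le> i" "xs = prefix k r" "trail (phase_at i) = r [k \<rightarrow> i]"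
    using arg_cong[OF xs(1), of length] arg_cong[OF xs(1), of "take k"]
      arg_cong[OF xs(1), of "drop k"]
    by (simp_all add: k_def)
  have phase: "origin (phase_at (i + d)) = origin (phase_at i) \<and>
      trail (phase_at (i + d)) = r [k \<rightarrow> i + d]" for d
    by (induction d) (use no_end k(1,3) in \<open>auto simp: advance_def\<close>)
  have "cls (target p (prefix k s)) = cls (origin (phase_at i))"
    unfolding xs(2) k(2)
    by (rule finite_run_cls[OF run_finite_run[OF s(1)] run_finite_run[OF r] refl])
  moreover have "target p (prefix k s) \<in> V"
    using run_finite_run[OF s(1)] target_in_V[OF _ p] by (simp add: finite_run_def)
  ultimately have "\<forall>\<^sub>F n in sequentially. event (origin (phase_at i)) (prefix n (suffix k w))"
    using event_eventually[OF _ _ suffix_in_words[OF w] run_suffix[OF s(1)]] s(2) by simp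
  then obtain n where n: "\<And>n'. n' \<ge> n \<Longrightarrow> event (origin (phase_at i)) (prefix n' (suffix k w))"
    by (auto simp: eventually_sequentially)
  have "map lbl (trail (phase_at (i + n)) @ [r (i + n)]) = w [k \<rightarrow> Suc (i + n)]"
    using run_subsequence[OF r, of k "Suc (i + n)"] phase[of n] k(1) by (simp add: finite_run_def)
  then have "completes_event (phase_at (i + n)) (r (i + n))"
    using n[of "Suc (i + n) - k"] k(1) phase[of n]
    by (simp add: completes_event_def subsequence_prefix_suffix del: subsequence_shift)
  with no_end show False
    by simp
qed

lemma goal_reached: "\<exists>k\<ge>i. goal (phase_at k) = goal (phase_at i) \<and> hit e (phase_at k) (r k)"
proof (rule ccontr)
  assume no_hit: "\<not> ?thesis"
  have "goal (phase_at k) = goal (phase_at i)" if "k \<ge> i" for k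
    using that by (induction k rule: dec_induct) (use no_hit in \<open>auto simp: advance_def\<close>)
  then have no_hit: "\<not> hit e (phase_at k) (r k)" if "k \<ge> i" for k
    using no_hit that by blast
  have antimono: "budget (phase_at k') \<le> budget (phase_at k)" if "i \<le> k" "k \<le> k'" for k k'
    using that(2)
    by (induction k' rule: dec_induct) (use no_hit that(1) in \<open>auto simp: advance_def\<close>)
  obtain k where k: "k \<ge> i" "\<And>k'. k' \<ge> i \<Longrightarrow> budget (phase_at k) \<le> budget (phase_at k')"
    using ex_has_least_nat[of "\<lambda>k. k \<ge> i" i "\<lambda>k. budget (phase_at k)"] by blast
  obtain k' where k': "k' \<ge> k" "completes_event (phase_at k') (r k')"
    using phase_ends[of k] no_hit k(1) le_trans by blast
  then have "budget (phase_at (Suc k')) < budget (phase_at k')"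
    using no_hit[of k'] k(1) viable_budget_pos[OF viable[of k']] by (simp add: advance_def)
  then show False
    using antimono[OF k(1) k'(1)] k(2)[of "Suc k'"] k(1) k'(1) by simp
qed

lemma goals_reached:
  "\<exists>k\<ge>i. goal (phase_at k) = goal (phase_at i) + d \<and> hit e (phase_at k) (r k)"
proof (induction d)
  case 0
  then show ?case
    using goal_reached by simp
next
  case (Suc d)
  then obtain k where k: "k \<ge> i" "goal (phase_at k) = goal (phase_at i) + d"
    "hit e (phase_at k) (r k)"
    by blast
  then have "goal (phase_at (Suc k)) = goal (phase_at i) + Suc d"
    by (simp add: advance_def start_def)
  moreover obtain k' where "k' \<ge> Suc k" "goal (phase_at k') = goal (phase_at (Suc k))"
    "hit e (phase_at k') (r k')"
    using goal_reached by blast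
  ultimately show ?case
    using k(1) by (intro exI[of _ k']) simp
qed

lemma chasing_accepts:
  assumes "\<And>c. c \<in> C \<Longrightarrow> \<exists>\<^sub>\<infinity>j. e j = c"
  shows "acc r"
  unfolding acc_iff gen_buchi_def INFM_nat_le
proof (intro ballI allI)
  fix c i
  assume "c \<in> C"
  then obtain j where j: "j \<ge> goal (phase_at i)" "e j = c"
    using assms unfolding INFM_nat_le by blast
  then obtain k where "k \<ge> i" "goal (phase_at k) = j" "hit e (phase_at k) (r k)"
    using goals_reached[of i "j - goal (phase_at i)"] by auto
  with j show "\<exists>k\<ge>i. c \<in> co (r k)"
    by (auto simp: hit_def)
qed

end

theorem buchi_resolvable:
  assumes "p \<in> V"
  shows "resolvable D Sg acc p"
proof (cases "C = {}")
  case True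
  then have "acc r" for r
    by (simp add: acc_iff gen_buchi_def)
  with default_strategy[OF assms] show ?thesis
    unfolding resolvable_def by blast
next
  case False
  obtain e :: "'c word" where e: "\<And>j. e j \<in> C" "\<And>c. c \<in> C \<Longrightarrow> \<exists>\<^sub>\<infinity>j. e j = c"
    using recurring_enumeration[OF countable_finite[OF finite_C] False] by blast
  from chasing_strategy[of p e, OF assms e(1)] obtain R
    where R: "strategy D Sg p R"
      "\<And>w n. w \<in> words Sg \<Longrightarrow> viable e (phase_after e p (prefix n (R w)))"
    by blast
  have "acc (R w)" if "w \<in> words Sg" "run D p w s" "acc s" for w s
    using that(1) strategy_run[OF R(1) that(1)] that(2,3) R(2)[OF that(1)] e(2)
    by (rule chasing_accepts[OF assms])
  with R(1) show ?thesis
    unfolding resolvable_def by blast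
qed

end

section \<open>Generalised coBuchi acceptance\<close>

definition edges :: "('s,'a) trans set \<Rightarrow> ('s \<times> 's) set" where
  "edges E = (\<lambda>t. (src t, tgt t)) ` E"

definition intra_scc :: "('s,'a) trans set \<Rightarrow> ('s,'a) trans set" where
  "intra_scc E = {t \<in> E. (tgt t, src t) \<in> (edges E)\<^sup>*}"

lemma edges_src_tgt: "t \<in> E \<Longrightarrow> (src t, tgt t) \<in> edges E"
  by (auto simp: edges_def)

lemma path_edges: "path E p ts \<Longrightarrow> (p, target p ts) \<in> (edges E)\<^sup>*"
  by (induction ts arbitrary: p) (auto intro: converse_rtrancl_into_rtrancl dest: edges_src_tgt)

lemma edges_intra_scc:
  assumes "(x, y) \<in> (edges E)\<^sup>*" "(y, x) \<in> (edges E)\<^sup>*"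
  shows "(x, y) \<in> (edges (intra_scc E))\<^sup>*"
  using assms
proof (induction rule: converse_rtrancl_induct)
  case (step x z)
  then obtain t where t: "t \<in> E" "x = src t" "z = tgt t"
    by (auto simp: edges_def)
  have "(z, x) \<in> (edges E)\<^sup>*" "(y, z) \<in> (edges E)\<^sup>*"
    using step by (auto intro: rtrancl_trans)
  with t have "(x, z) \<in> edges (intra_scc E)"
    by (auto simp: edges_def intra_scc_def)
  with step.IH \<open>(y, z) \<in> (edges E)\<^sup>*\<close> show ?case
    by (auto intro: converse_rtrancl_into_rtrancl)
qed simp

lemma intra_scc_reverse: "t \<in> intra_scc E \<Longrightarrow> (tgt t, src t) \<in> (edges (intra_scc E))\<^sup>*"
  by (rule edges_intra_scc) (auto simp: intra_scc_def intro: edges_src_tgt)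

lemma recurring_intra_scc:
  assumes r: "run D p w r" and E: "\<And>i. i \<ge> k \<Longrightarrow> r i \<in> E" and "r k \<in> limit r"
  shows "r k \<in> intra_scc E"
proof -
  obtain j where j: "j > k" "r j = r k"
    using assms(3) by (auto simp: limit_iff_frequent INFM_nat)
  have "path D (tgt (r k)) (r [Suc k \<rightarrow> j])"
    using run_subsequence[OF r, of "Suc k" j] by (simp add: finite_run_def)
  then have "path E (tgt (r k)) (r [Suc k \<rightarrow> j])"
    by (rule path_restrict) (use E in auto)
  then have "(tgt (r k), target (tgt (r k)) (r [Suc k \<rightarrow> j])) \<in> (edges E)\<^sup>*"
    by (rule path_edges)
  moreover have "prefix j r = prefix (Suc k) r @ (r [Suc k \<rightarrow> j])"
    using j(1) by (intro prefix_eq_append_subsequence) simp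
  then have "target p (prefix j r) = target (tgt (r k)) (r [Suc k \<rightarrow> j])"
    by simp
  then have "target (tgt (r k)) (r [Suc k \<rightarrow> j]) = src (r k)"
    using r[unfolded run_iff, rule_format, of j] j(2) by simp
  ultimately show ?thesis
    using E by (simp add: intra_scc_def)
qed

lemma run_eventually_intra_scc:
  assumes "finite E" and r: "run D p w r" and "\<forall>\<^sub>F i in sequentially. r i \<in> E"
  obtains n where "run (intra_scc E) (target p (prefix n r)) (suffix n w) (suffix n r)"
proof -
  obtain m where m: "\<And>i. i \<ge> m \<Longrightarrow> r i \<in> E"
    using assms(3) by (auto simp: eventually_sequentially)
  have "range r \<subseteq> r ` {..<m} \<union> E"
    using m by (metis UnCI image_eqI image_subsetI lessThan_iff not_less)
  then have "finite (range r)"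
    using assms(1) by (auto intro: finite_subset)
  then obtain l where l: "limit r = range (suffix l r)"
    using limit_is_suffix by blast
  define n where "n = max m l"
  have "suffix n r i \<in> intra_scc E" for i
  proof -
    have "r (n + i) = suffix l r (n + i - l)"
      by (simp add: n_def)
    then have "r (n + i) \<in> limit r"
      unfolding l by blast
    then have "r (n + i) \<in> intra_scc E"
      by (intro recurring_intra_scc[OF r]) (auto simp: n_def intro: m)
    then show ?thesis
      by simp
  qed
  with run_suffix[OF r, of n]
  have "run (intra_scc E) (target p (prefix n r)) (suffix n w) (suffix n r)"
    by (simp add: run_iff)
  then show ?thesis
    by (rule that)
qed

context arena
begin

definition peers :: "'s \<Rightarrow> 'a list \<Rightarrow> 's set" where
  "peers p u = {q \<in> V. \<exists>ts. finite_run D p u ts \<and> cls (target p ts) = cls q}"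

lemma peers_cls:
  assumes "q \<in> peers p u" "q' \<in> peers p u"
  shows "cls q = cls q'"
proof -
  obtain ts ts' where "finite_run D p u ts" "cls (target p ts) = cls q"
    "finite_run D p u ts'" "cls (target p ts') = cls q'"
    using assms by (auto simp: peers_def)
  then show ?thesis
    using finite_run_cls[of p u ts p ts'] by simp
qed

lemma peers_cls_closed: "q \<in> peers p u \<Longrightarrow> q' \<in> V \<Longrightarrow> cls q' = cls q \<Longrightarrow> q' \<in> peers p u"
  by (auto simp: peers_def)

lemma target_in_peers: "p \<in> V \<Longrightarrow> finite_run D p u ts \<Longrightarrow> target p ts \<in> peers p u"
  by (auto simp: peers_def finite_run_def target_in_V)

lemma peers_append:
  assumes p: "p \<in> V" and "q \<in> peers p u" "finite_run D q v ys"
  shows "target q ys \<in> peers p (u @ v)"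
proof -
  obtain ts where ts: "finite_run D p u ts" "cls (target p ts) = cls q" and q: "q \<in> V"
    using assms(2) by (auto simp: peers_def)
  have "set v \<subseteq> Sg" "target p ts \<in> V"
    using assms(3) path_labels[of q ys] ts(1) target_in_V[OF _ p] by (auto simp: finite_run_def)
  then obtain zs where zs: "finite_run D (target p ts) v zs"
    using ex_finite_run by blast
  then have "finite_run D p (u @ v) (ts @ zs)"
    using ts(1) by (simp add: finite_run_append finite_run_length)
  moreover have "cls (target p (ts @ zs)) = cls (target q ys)"
    using finite_run_cls[OF zs assms(3) ts(2)] by simp
  moreover have "target q ys \<in> V"
    using assms(3) q target_in_V by (simp add: finite_run_def)
  ultimately show ?thesis
    by (auto simp: peers_def)
qed

end

locale cobuchi_arena = arena D Sg acc V cls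
  for D :: "('s,'a) trans set" and Sg :: "'a set" and acc :: "('s,'a) trans word \<Rightarrow> bool"
    and V :: "'s set" and cls :: "'s \<Rightarrow> 'k" +
  fixes co :: "('s,'a) trans \<Rightarrow> 'c set" and C :: "'c set"
  assumes acc_iff: "acc r \<longleftrightarrow> gen_cobuchi C (\<lambda>i. co (r i))" and finite_C: "finite C"
begin

definition core :: "'c \<Rightarrow> ('s,'a) trans set" where
  "core c = intra_scc {t \<in> D. c \<notin> co t}"

definition breach :: "'c \<Rightarrow> 's \<Rightarrow> 'c \<Rightarrow> ('s,'a) trans list \<Rightarrow> bool" where
  "breach c q d h \<longleftrightarrow> (\<exists>t\<in>set h. d \<in> co t) \<and> (\<exists>xs. finite_run (core c) q (map lbl h) xs)"

definition covered :: "'c \<Rightarrow> 's \<Rightarrow> bool" where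
  "covered c q \<longleftrightarrow> (\<exists>p\<in>V. cls p = cls q \<and> (\<exists>d\<in>C. \<forall>n. \<not> forces D Sg n (breach c q d) p))"

lemma coreD: "t \<in> core c \<Longrightarrow> t \<in> D \<and> c \<notin> co t"
  by (auto simp: core_def intra_scc_def)

lemma covered_step:
  assumes t: "t \<in> core c" and "covered c (src t)"
  shows "covered c (tgt t)"
proof -
  have tD: "t \<in> D" "lbl t \<in> Sg"
    using coreD[OF t] transD by blast+
  obtain p d where p: "cls p = cls (src t)" "d \<in> C"
    "\<And>n. \<not> forces D Sg n (breach c (src t) d) p"
    using assms(2) by (auto simp: covered_def)
  obtain t' where t': "t' \<in> D" "src t' = p" "lbl t' = lbl t"
    and unforced: "\<And>n. \<not> forces D Sg n (\<lambda>h. breach c (src t) d (t' # h)) (tgt t')"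
    using not_forces_step[OF finite_D p(3) tD(2)] by blast
  have "breach c (src t) d (t' # h)" if "breach c (tgt t) d h" for h
  proof -
    obtain xs where "finite_run (core c) (tgt t) (map lbl h) xs"
      using \<open>breach c (tgt t) d h\<close> by (auto simp: breach_def)
    then have "finite_run (core c) (src t) (map lbl (t' # h)) (t # xs)"
      using t t'(3) by (simp add: finite_run_def)
    then show ?thesis
      using \<open>breach c (tgt t) d h\<close> by (auto simp: breach_def)
  qed
  then have "\<not> forces D Sg n (breach c (tgt t) d) (tgt t')" for n
    using unforced[of n]
      forces_weaken[of D Sg n "breach c (tgt t) d" "tgt t'" "\<lambda>h. breach c (src t) d (t' # h)"]
    by blast
  moreover have "cls (tgt t') = cls (tgt t)"
    using cls_step[OF t'(1) tD(1) t'(3)] t'(2) p(1) by simp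
  ultimately show ?thesis
    using transD[OF t'(1)] p(2) by (auto simp: covered_def)
qed

lemma covered_core_iff:
  assumes "t \<in> core c"
  shows "covered c (tgt t) \<longleftrightarrow> covered c (src t)"
proof
  assume "covered c (tgt t)"
  moreover have "(tgt t, src t) \<in> (edges (core c))\<^sup>*"
    using assms intra_scc_reverse by (simp add: core_def)
  then have "covered c (tgt t) \<longrightarrow> covered c (src t)"
    by (induction rule: rtrancl_induct) (use covered_step in \<open>unfold edges_def, blast+\<close>)
  ultimately show "covered c (src t)"
    by blast
qed (rule covered_step[OF assms])

lemma covered_path_iff: "path (core c) q xs \<Longrightarrow> covered c (target q xs) \<longleftrightarrow> covered c q"
  by (induction xs arbitrary: q) (auto simp: covered_core_iff)

lemma breach_imp_block:
  assumes "breach c x d h" "\<not> covered c x"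
  shows "block (\<lambda>p x. \<not> covered c x)
    (\<lambda>h xs. (\<exists>t\<in>set h. d \<in> co t) \<and> (\<forall>t\<in>set xs. c \<notin> co t)) p x h"
proof -
  obtain xs where xs: "finite_run (core c) x (map lbl h) xs"
    using assms(1) by (auto simp: breach_def)
  then have "path (core c) x xs"
    by (simp add: finite_run_def)
  then have "\<not> covered c (target x xs)" "\<forall>t\<in>set xs. c \<notin> co t"
    using assms(2) covered_path_iff path_subset[of "core c" x xs] coreD by blast+
  moreover have "finite_run D x (map lbl h) xs"
    using coreD by (intro finite_run_mono[OF xs]) blast
  ultimately show ?thesis
    using assms(1) by (auto simp: block_def breach_def)
qed

lemma all_covered:
  assumes q: "q \<in> V" and c: "c \<in> C"
  shows "covered c q"
proof (rule ccontr)
  assume "\<not> covered c q"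
  define Q where "Q d h xs \<longleftrightarrow> (\<exists>t\<in>set h. d \<in> co t) \<and> (\<forall>t\<in>set xs. c \<notin> co t)" for d h xs
  obtain e :: "'c word" where e: "\<And>j. e j \<in> C" "\<And>d. d \<in> C \<Longrightarrow> \<exists>\<^sub>\<infinity>j. e j = d"
    using recurring_enumeration[OF countable_finite[OF finite_C]] c by blast
  have forced: "\<exists>n. forces D Sg n (block (\<lambda>p x. \<not> covered c x) (Q d) p x) p"
    if px: "p \<in> V" "x \<in> V" "cls p = cls x" "\<not> covered c x" and d: "d \<in> range e" for p x d
  proof -
    obtain n where n: "forces D Sg n (breach c x d) p"
      using px d e(1) unfolding covered_def by blast
    have "block (\<lambda>p x. \<not> covered c x) (Q d) p x h" if "breach c x d h" for h
      unfolding Q_def[abs_def] using that px(4) by (rule breach_imp_block)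
    with forces_weaken[OF n, of "block (\<lambda>p x. \<not> covered c x) (Q d) p x"] show ?thesis
      by blast
  qed
  have "finite (range e)"
    using e(1) by (auto intro: finite_subset[OF _ finite_C])
  from forced_blocks[where \<Psi> = "\<lambda>p x. \<not> covered c x" and Q = Q and e = e,
      OF q q refl \<open>\<not> covered c q\<close> this forced]
  obtain r t T where r: "acc t \<longrightarrow> acc r" and T: "idx_sequence T"
    and blocks: "\<And>k. Q (e k) (r [T k \<rightarrow> T (Suc k)]) (t [T k \<rightarrow> T (Suc k)])"
    by blast
  have "c \<notin> co (t i)" for i
    using T by (rule idx_sequence_all[where P = "\<lambda>y. c \<notin> co y"]) (use blocks in \<open>auto simp: Q_def\<close>)
  then have "acc t"
    using c by (auto simp: acc_iff gen_cobuchi_def intro: bexI[of _ c])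
  then obtain d where d: "d \<in> C" "finite {i. d \<in> co (r i)}"
    using r by (auto simp: acc_iff gen_cobuchi_def)
  have "\<exists>\<^sub>\<infinity>k. \<exists>y\<in>set (r [T k \<rightarrow> T (Suc k)]). d \<in> co y"
    using e(2)[OF d(1)] by (rule INFM_mono) (use blocks in \<open>auto simp: Q_def\<close>)
  then have "\<exists>\<^sub>\<infinity>i. d \<in> co (r i)"
    by (rule idx_sequence_INFM[where P = "\<lambda>y. d \<in> co y", OF T])
  with d(2) show False
    by (simp add: INFM_iff_infinite)
qed

lemma core_strategy:
  assumes "q \<in> V" "c \<in> C"
  shows "\<exists>b\<in>V. cls b = cls q \<and> (\<exists>Y. strategy D Sg b Y \<and> (\<forall>w\<in>words Sg.
    (\<forall>n. \<exists>xs. finite_run (core c) q (prefix n w) xs) \<longrightarrow> acc (Y w)))"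
proof -
  obtain b d where b: "b \<in> V" "cls b = cls q" and d: "d \<in> C"
    and unforced: "\<And>n. \<not> forces D Sg n (breach c q d) b"
    using all_covered[OF assms] by (auto simp: covered_def)
  from avoiding_strategy[OF finite_D unforced] obtain Y
    where Y: "strategy D Sg b Y" "\<And>w n. w \<in> words Sg \<Longrightarrow> \<not> breach c q d (prefix n (Y w))"
    by blast
  have "acc (Y w)"
    if w: "w \<in> words Sg" and alive: "\<forall>n. \<exists>xs. finite_run (core c) q (prefix n w) xs" for w
  proof -
    have "d \<notin> co (Y w i)" for i
    proof
      assume "d \<in> co (Y w i)"
      moreover have "map lbl (prefix (Suc i) (Y w)) = prefix (Suc i) w"
        using run_finite_run[OF strategy_run[OF Y(1) w]] unfolding finite_run_def by blast
      ultimately have "breach c q d (prefix (Suc i) (Y w))"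
        using alive[rule_format, of "Suc i"] unfolding breach_def by auto
      with Y(2)[OF w] show False
        by blast
    qed
    with d show ?thesis
      by (auto simp: acc_iff gen_cobuchi_def intro: bexI[of _ d])
  qed
  with b Y(1) show ?thesis
    by blast
qed

text \<open>A thread \<open>(s, q, c)\<close> hopes for a run that stays inside a component without \<open>c\<close> from
  time \<open>s\<close> on, when it is in state \<open>q\<close>. It is alive after \<open>u\<close> as long as there is such a run.\<close>

fun alive :: "'s \<Rightarrow> nat \<times> 's \<times> 'c \<Rightarrow> 'a list \<Rightarrow> bool" where
  "alive p (s, q, c) u \<longleftrightarrow> s \<le> length u \<and> q \<in> peers p (take s u) \<and>
     (\<exists>xs. finite_run (core c) q (drop s u) xs)"

lemma alive_antimono:
  assumes "alive p (s, q, c) (prefix n w)" "s \<le> m" "m \<le> n"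
  shows "alive p (s, q, c) (prefix m w)"
proof -
  obtain xs where "finite_run (core c) q (w [s \<rightarrow> n]) xs"
    using assms(1) by auto
  from finite_run_take[OF this, of "m - s"] show ?thesis
    using assms by (auto simp: min_def)
qed

lemma alive_eventually:
  "(\<forall>\<^sub>F n in sequentially. alive p x (prefix n w)) \<or>
    (\<forall>\<^sub>F n in sequentially. \<not> alive p x (prefix n w))"
proof -
  obtain s q c where x: "x = (s, q, c)"
    by (cases x)
  show ?thesis
  proof (cases "\<forall>n\<ge>s. alive p x (prefix n w)")
    case True
    then show ?thesis
      by (auto simp: eventually_sequentially)
  next
    case False
    then obtain m where "m \<ge> s" "\<not> alive p x (prefix m w)"
      by blast
    then have "\<not> alive p x (prefix n w)" if "n \<ge> m" for n
      using alive_antimono that unfolding x by blast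
    then show ?thesis
      by (auto simp: eventually_sequentially)
  qed
qed

lemma accepted_alive:
  assumes p: "p \<in> V" and r: "run D p w r" "acc r"
  obtains s q c where "q \<in> V" "c \<in> C" "\<And>n. n \<ge> s \<Longrightarrow> alive p (s, q, c) (prefix n w)"
proof -
  obtain c where c: "c \<in> C" "finite {i. c \<in> co (r i)}"
    using r(2) by (auto simp: acc_iff gen_cobuchi_def)
  have "finite {t \<in> D. c \<notin> co t}"
    using finite_D by simp
  moreover have "\<forall>\<^sub>F i in sequentially. r i \<in> {t \<in> D. c \<notin> co t}"
    using r(1) c(2) by (simp add: run_iff eventually_cofinite flip: cofinite_eq_sequentially)
  ultimately obtain s
    where s: "run (core c) (target p (prefix s r)) (suffix s w) (suffix s r)"
    unfolding core_def by (rule run_eventually_intra_scc[OF _ r(1)])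
  have q: "target p (prefix s r) \<in> peers p (prefix s w)"
    using target_in_peers[OF p run_finite_run[OF r(1)]] .
  show ?thesis
  proof (rule that)
    show "target p (prefix s r) \<in> V"
      using q by (simp add: peers_def)
    show "alive p (s, target p (prefix s r), c) (prefix n w)" if "n \<ge> s" for n
      using q run_finite_run[OF s, of "n - s"] that by (auto simp: min_def)
  qed (rule c(1))
qed

lemma alive_core_run:
  assumes "s \<le> length u" and alive: "\<And>n. alive p (s, q, c) (u @ prefix n w)"
  shows "\<exists>xs. finite_run (core c) q (prefix n (drop s u \<frown> w)) xs"
proof -
  obtain xs where "finite_run (core c) q (drop s u @ prefix n w) xs"
    using alive[of n] assms(1) by auto
  moreover have "take n (drop s u @ prefix n w) = prefix n (drop s u \<frown> w)"
    by (cases "n \<le> length (drop s u)") simp_all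
  ultimately show ?thesis
    by (metis finite_run_take)
qed

text \<open>Eve first imitates the core strategy that was started together with the thread; the state
  reached by it is dominated by her own one.\<close>

lemma thread_strategy:
  assumes p: "p \<in> V" and c: "c \<in> C" and alive: "alive p (s, q, c) u" and x: "x \<in> peers p u"
  shows "\<exists>Z. strategy D Sg x Z \<and> (\<forall>w\<in>words Sg.
    (\<forall>n. alive p (s, q, c) (u @ prefix n w)) \<longrightarrow> acc (Z w))"
proof -
  define v where "v = drop s u"
  have s: "s \<le> length u" and q: "q \<in> peers p (take s u)" and u: "take s u @ v = u"
    using alive by (auto simp: v_def)
  have "q \<in> V"
    using q by (simp add: peers_def)
  from core_strategy[OF this c] obtain b Y
    where b: "b \<in> V" "cls b = cls q" and Y: "strategy D Sg b Y"
      and Y_acc: "\<And>w. w \<in> words Sg \<Longrightarrow> \<forall>n. \<exists>xs. finite_run (core c) q (prefix n w) xs \<Longrightarrow> acc (Y w)"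
    by blast
  obtain xs where "finite_run (core c) q v xs"
    using alive by (auto simp: v_def)
  then have v: "set v \<subseteq> Sg"
    using path_subset[of "core c" q xs] coreD transD by (fastforce simp: finite_run_def)
  obtain ys where ys: "finite_run D b v ys"
    and Y': "strategy D Sg (target b ys) (\<lambda>w. suffix (length v) (Y (v \<frown> w)))"
    by (rule strategy_residual[OF Sg_nonempty Y v])
  have peer: "target b ys \<in> peers p u"
    using peers_append[OF p peers_cls_closed[OF q b] ys] by (simp add: u)
  have "dominates x (target b ys)"
    using x peer peers_cls[OF x peer] by (intro cls_dominates) (simp_all add: peers_def)
  then obtain F where F: "beats 1 F x (target b ys)"
    by (auto simp: dominates_def)
  have "acc (F w (suffix (length v) (Y (v \<frown> w))))"
    if w: "w \<in> words Sg" and alive: "\<forall>n. alive p (s, q, c) (u @ prefix n w)" for w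
  proof -
    have "\<exists>xs. finite_run (core c) q (prefix n (v \<frown> w)) xs" for n
      unfolding v_def using s alive by (intro alive_core_run) auto
    then have "acc (suffix (length v) (Y (v \<frown> w)))"
      using Y_acc w v by simp
    then show ?thesis
      by (rule beats_acc[OF F w strategy_run[OF Y' w]])
  qed
  with beats_strategy[OF F Y'] show ?thesis
    by blast
qed

definition thread :: "nat \<Rightarrow> nat \<times> 's \<times> 'c" where
  "thread = from_nat_into (UNIV \<times> V \<times> C)"

definition current :: "'s \<Rightarrow> 'a list \<Rightarrow> nat" where
  "current p u = (LEAST i. alive p (thread i) u)"

lemma range_thread: "p \<in> V \<Longrightarrow> C \<noteq> {} \<Longrightarrow> range thread = UNIV \<times> V \<times> C"
  unfolding thread_def using finite_V finite_C
  by (intro range_from_nat_into countable_SIGMA) (auto intro: countable_finite)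

lemma current_alive:
  assumes p: "p \<in> V" and "C \<noteq> {}" "set u \<subseteq> Sg"
  shows "alive p (thread (current p u)) u"
proof -
  obtain c ts where c: "c \<in> C" and "finite_run D p u ts"
    using assms ex_finite_run by blast
  then have q: "target p ts \<in> peers p u"
    using target_in_peers[OF p] by blast
  then have "alive p (length u, target p ts, c) u"
    by (auto intro: exI[of _ "[]"])
  moreover have "(length u, target p ts, c) \<in> range thread"
    using q c by (simp add: range_thread[OF assms(1,2)] peers_def)
  ultimately show ?thesis
    unfolding current_def by (metis LeastI rangeE)
qed

lemma current_stabilises:
  assumes p: "p \<in> V" and "C \<noteq> {}" and r: "run D p w r" "acc r"
  shows "\<exists>N. \<forall>n\<ge>N. current p (prefix n w) = current p (prefix N w)"
proof -
  obtain s q c where "q \<in> V" "c \<in> C" and alive: "\<And>n. n \<ge> s \<Longrightarrow> alive p (s, q, c) (prefix n w)"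
    by (rule accepted_alive[OF p r]) blast
  then have "(s, q, c) \<in> range thread"
    by (simp add: range_thread[OF assms(1,2)])
  then obtain j where "(s, q, c) = thread j"
    by blast
  with alive have "\<forall>\<^sub>F n in sequentially. alive p (thread j) (prefix n w)"
    unfolding eventually_sequentially by metis
  then obtain i where "\<forall>\<^sub>F n in sequentially. current p (prefix n w) = i"
    unfolding current_def
    using Least_eventually_constant[of "\<lambda>i n. alive p (thread i) (prefix n w)"] alive_eventually
    by blast
  then obtain N where "\<And>n. n \<ge> N \<Longrightarrow> current p (prefix n w) = i"
    by (auto simp: eventually_sequentially)
  then show ?thesis
    by (intro exI[of _ N]) simp
qed

lemma current_thread_strategy:
  assumes p: "p \<in> V" and C: "C \<noteq> {}" and h: "path D p h"
  shows "\<exists>Z. strategy D Sg (target p h) Z \<and> (\<forall>w\<in>words Sg.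
    (\<forall>n. alive p (thread (current p (map lbl h))) (map lbl h @ prefix n w)) \<longrightarrow> acc (Z w))"
proof -
  let ?u = "map lbl h"
  obtain s q c where thread: "thread (current p ?u) = (s, q, c)"
    by (cases "thread (current p ?u)")
  then have "c \<in> C"
    using range_thread[OF p C] by (metis SigmaE2 rangeI)
  moreover have "alive p (s, q, c) ?u"
    using current_alive[OF p C, of ?u] path_labels[OF h] by (simp flip: thread)
  moreover have "target p h \<in> peers p ?u"
    using target_in_peers[OF p] h by (simp add: finite_run_def)
  ultimately show ?thesis
    unfolding thread by (rule thread_strategy[OF p])
qed

theorem cobuchi_resolvable:
  assumes p: "p \<in> V"
  shows "resolvable D Sg acc p"
proof (cases "C = {}")
  case True
  then have "\<not> acc r" for r
    by (simp add: acc_iff gen_cobuchi_def)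
  with default_strategy[OF p] show ?thesis
    unfolding resolvable_def by blast
next
  case C: False
  let ?achieves = "\<lambda>h w r.
    (\<forall>n. alive p (thread (current p (map lbl h))) (map lbl h @ prefix n w)) \<longrightarrow> acc r"
  from restarting_strategy_achieves[where \<iota> = "current p" and achieves = ?achieves,
      OF current_thread_strategy[OF p C]]
  obtain R where R: "strategy D Sg p R"
    and restart: "\<And>w N. w \<in> words Sg \<Longrightarrow>
      \<forall>n\<ge>N. current p (prefix n w) = current p (prefix N w) \<Longrightarrow>
      \<exists>s. (\<forall>n\<ge>s. current p (prefix n w) = current p (prefix s w)) \<and>
        ?achieves (prefix s (R w)) (suffix s w) (suffix s (R w))"
    by blast
  have "acc (R w)" if w: "w \<in> words Sg" and r: "run D p w r" "acc r" for w r
  proof -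
    obtain s where s: "\<And>n. n \<ge> s \<Longrightarrow> current p (prefix n w) = current p (prefix s w)"
      and achieved: "?achieves (prefix s (R w)) (suffix s w) (suffix s (R w))"
      using restart[OF w] current_stabilises[OF p C r] by blast
    have "map lbl (prefix s (R w)) = prefix s w"
      using run_finite_run[OF strategy_run[OF R w]] unfolding finite_run_def by blast
    moreover have "alive p (thread (current p (prefix s w))) (prefix s w @ prefix n (suffix s w))"
      for n
      using current_alive[OF p C set_subsequence_words[OF w], of 0 "s + n"] s[of "s + n"]
      by (simp flip: subsequence_append)
    ultimately have "acc (suffix s (R w))"
      using achieved by metis
    then show ?thesis
      by simp
  qed
  with R show ?thesis
    unfolding resolvable_def by blast
qed

end

section \<open>Optimal moves\<close>

context token_game
begin

definition optimal :: "('s,'a) trans set" where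
  "optimal = {t \<in> D. dominates (src t) (src t) \<and>
     (\<forall>t'\<in>D. src t' = src t \<longrightarrow> lbl t' = lbl t \<longrightarrow> dominates (tgt t) (tgt t'))}"

lemma optimal_subset: "optimal \<subseteq> D"
  by (auto simp: optimal_def)

lemma ex_optimal: "dominates p p \<Longrightarrow> a \<in> Sg \<Longrightarrow> \<exists>t\<in>optimal. src t = p \<and> lbl t = a"
  using dominates_step[of p p a] unfolding optimal_def by blast

lemma optimal_dominates:
  assumes "t \<in> optimal" "t' \<in> D" "lbl t = lbl t'" "lbl t \<in> Sg" "dominates (src t) (src t')"
  shows "dominates (tgt t) (tgt t')"
proof -
  obtain s where s: "s \<in> D" "src s = src t" "lbl s = lbl t" "dominates (tgt s) (tgt t')"
    using dominates_step[OF assms(5,4)] assms(2,3) by metis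
  then have "dominates (tgt t) (tgt s)"
    using assms(1) by (simp add: optimal_def)
  then show ?thesis
    using s(4) by (rule dominates_trans)
qed

lemma optimal_run_dominates:
  "finite_run optimal q u ts \<Longrightarrow> finite_run D p u hs \<Longrightarrow> set u \<subseteq> Sg \<Longrightarrow> dominates q p \<Longrightarrow>
    dominates (target q ts) (target p hs)"
proof (induction u arbitrary: p q ts hs)
  case (Cons a u)
  then obtain t ts' h hs' where ts: "ts = t # ts'" "hs = h # hs'"
    by (auto simp: finite_run_def)
  then have "dominates (tgt t) (tgt h)"
    using optimal_dominates[of t h] Cons.prems by (auto simp: finite_run_def)
  then show ?case
    using Cons.IH[of "tgt t" ts' "tgt h" hs'] Cons.prems ts by (auto simp: finite_run_def)
qed (simp add: finite_run_def)

text \<open>If Eve plays from \<open>p\<close> against an optimal token that starts in a state equivalent to \<open>p\<close>, then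
  she stays equivalent to the token, and hence her own moves are optimal as well.\<close>

lemma beats_optimal_move:
  assumes F: "beats 1 F p q" and "dominates q p" and w: "w \<in> words Sg"
    and t: "finite_run optimal q (prefix n w) (prefix n t)"
  shows "F w t n \<in> optimal"
proof -
  let ?p = "target p (prefix n (F w t))" and ?q = "target q (prefix n t)"
  have tD: "finite_run D q (prefix n w) (prefix n t)"
    using t optimal_subset by (rule finite_run_mono)
  from beats_legal[OF F w tD]
  have move: "finite_run D p (prefix n w) (prefix n (F w t))"
    "F w t n \<in> D" "src (F w t n) = ?p" "lbl (F w t n) = w n"
    by (simp_all add: finite_run_snoc)
  have pq: "dominates ?p ?q"
    by (rule dominates_residual[OF F w tD])
  have qp: "dominates ?q ?p"
    by (rule optimal_run_dominates[OF t move(1) set_subsequence_words[OF w] assms(2)])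
  have "dominates (tgt (F w t n)) (tgt t')"
    if t': "t' \<in> D" "src t' = ?p" "lbl t' = w n" for t'
  proof -
    have "dominates ?q ?q"
      using qp pq by (rule dominates_trans)
    then obtain s where s: "s \<in> optimal" "src s = ?q" "lbl s = w n"
      using ex_optimal words_nth[OF w] by blast
    then have st': "dominates (tgt s) (tgt t')"
      using optimal_dominates[of s t'] t' qp words_nth[OF w] by simp
    have "dominates (tgt (F w t n)) (tgt s)"
      using beats_move_dominates[OF F w tD] s optimal_subset by blast
    then show ?thesis
      using st' by (rule dominates_trans)
  qed
  moreover have "dominates ?p ?p"
    using pq qp by (rule dominates_trans)
  ultimately show ?thesis
    using move by (simp add: optimal_def)
qed

lemma beats_optimal:
  assumes F: "beats 1 F p q" and "dominates q p" and w: "w \<in> words Sg"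
    and t: "finite_run optimal q (prefix n w) (prefix n t)"
  shows "finite_run optimal p (prefix (Suc n) w) (prefix (Suc n) (F w t))"
proof (rule finite_run_restrict)
  show "finite_run D p (prefix (Suc n) w) (prefix (Suc n) (F w t))"
    using beats_legal[OF F w finite_run_mono[OF t optimal_subset]] by simp
  have "F w t k \<in> optimal" if "k \<le> n" for k
    using beats_optimal_move[OF assms(1-3) finite_run_prefix[OF t that]] .
  then show "set (prefix (Suc n) (F w t)) \<subseteq> optimal"
    by (auto simp del: subseq_to_Suc)
qed

lemma dominates_optimal:
  assumes "dominates p q" "dominates q p"
  shows "token_game.dominates optimal Sg acc p q"
proof -
  interpret optimal: token_game optimal Sg acc
    by standard (rule acc_suffix)
  obtain F where F: "beats 1 F p q"
    using assms(1) by (auto simp: dominates_def)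
  have "optimal.beats 1 F p q"
    unfolding optimal.beats_def
  proof (intro conjI ballI allI impI)
    fix w t n
    assume "w \<in> words Sg" "finite_run optimal q (prefix n w) (prefix n t)"
    then show "finite_run optimal p (prefix (n + 1) w) (prefix (n + 1) (F w t))"
      using beats_optimal[OF F assms(2)] by simp
  next
    fix w t
    assume "w \<in> words Sg" "run optimal q w t" "acc t"
    then show "acc (F w t)"
      using beats_acc[OF F] run_mono[OF _ optimal_subset] by blast
  qed (rule beats_delayed[OF F])
  then show ?thesis
    by (auto simp: optimal.dominates_def)
qed

end

section \<open>From the two-token game to an arena\<close>

locale two_token_game = token_game D Sg acc + finite_graph D Sg V
  for D :: "('s,'a) trans set" and Sg :: "'a set" and acc :: "('s,'a) trans word \<Rightarrow> bool"
    and V :: "'s set" +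
  fixes q\<^sub>0 :: 's
    and T :: "'a word \<Rightarrow> ('s,'a) trans word \<Rightarrow> ('s,'a) trans word \<Rightarrow> ('s,'a) trans word"
  assumes init_in_V: "q\<^sub>0 \<in> V"
    and T_causal: "prefix n w = prefix n w' \<Longrightarrow> prefix (n - 1) t = prefix (n - 1) t' \<Longrightarrow>
      prefix (n - 1) s = prefix (n - 1) s' \<Longrightarrow> prefix n (T w t s) = prefix n (T w' t' s')"
    and T_legal: "w \<in> words Sg \<Longrightarrow> finite_run D q\<^sub>0 (prefix n w) (prefix n t) \<Longrightarrow>
      finite_run D q\<^sub>0 (prefix n w) (prefix n s) \<Longrightarrow>
      finite_run D q\<^sub>0 (prefix (Suc n) w) (prefix (Suc n) (T w t s))"
    and T_wins: "w \<in> words Sg \<Longrightarrow> run D q\<^sub>0 w t \<Longrightarrow> run D q\<^sub>0 w s \<Longrightarrow> acc t \<or> acc s \<Longrightarrow> acc (T w t s)"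
begin

lemma beats_with_second_token:
  assumes \<rho>: "strategy D Sg q\<^sub>0 \<rho>"
  shows "beats 1 (\<lambda>w. T w (\<rho> w)) q\<^sub>0 q\<^sub>0"
  unfolding beats_def
proof (intro conjI ballI allI impI)
  show "delayed 1 (\<lambda>w. T w (\<rho> w))"
    unfolding delayed_def
  proof (intro allI impI)
    fix w w' :: "'a word" and t t' :: "('s,'a) trans word" and n
    assume w: "prefix n w = prefix n w'" and t: "prefix (n - 1) t = prefix (n - 1) t'"
    show "prefix n (T w (\<rho> w) t) = prefix n (T w' (\<rho> w') t')"
      by (rule T_causal[OF w causalD[OF strategy_causal[OF \<rho>] prefix_eq_mono[OF w diff_le_self]] t])
  qed
next
  fix w t n
  assume "w \<in> words Sg" "finite_run D q\<^sub>0 (prefix n w) (prefix n t)"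
  then show "finite_run D q\<^sub>0 (prefix (n + 1) w) (prefix (n + 1) (T w (\<rho> w) t))"
    using T_legal[OF _ run_finite_run[OF strategy_run[OF \<rho>]]] by simp
qed (use T_wins strategy_run[OF \<rho>] in blast)

lemma dominates_init: "dominates q\<^sub>0 q\<^sub>0"
proof -
  have "beats 1 (\<lambda>w t. T w t t) q\<^sub>0 q\<^sub>0"
    unfolding beats_def
  proof (intro conjI ballI allI impI)
    show "delayed 1 (\<lambda>w t. T w t t)"
      unfolding delayed_def using T_causal by blast
  qed (use T_legal T_wins in auto)
  then show ?thesis
    by (auto simp: dominates_def)
qed

definition live :: "'s set" where
  "live = {p \<in> V. \<forall>n. \<not> forces D Sg n (\<lambda>_. False) p}"

lemma live_step:
  assumes "p \<in> live" "a \<in> Sg"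
  shows "\<exists>t\<in>D. src t = p \<and> lbl t = a \<and> tgt t \<in> live"
  using not_forces_step[OF finite_D _ assms(2), of "\<lambda>_. False" p] assms(1) transD
  unfolding live_def by fastforce

lemma accepting_live_run:
  assumes w: "w \<in> words Sg" and r: "run D q\<^sub>0 w r" "acc r"
  obtains r' where "run D q\<^sub>0 w r'" "acc r'" "\<And>n. target q\<^sub>0 (prefix n r') \<in> live"
proof -
  have "\<forall>\<^sub>F n in sequentially. \<forall>p\<in>V - live. forces D Sg n (\<lambda>_. False) p"
    using finite_V by (intro eventually_ball_finite) (auto simp: eventually_forces_iff live_def)
  then obtain K where K: "\<And>p. p \<in> V - live \<Longrightarrow> forces D Sg K (\<lambda>_. False) p"
    by (auto simp: eventually_sequentially)
  obtain F where F: "beats K F q\<^sub>0 q\<^sub>0"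
    by (rule beats_delay[OF dominates_init dominates_init])
  let ?r = "F w r"
  have r': "run D q\<^sub>0 w ?r"
    by (rule beats_run[OF F w r(1)])
  have "target q\<^sub>0 (prefix n ?r) \<in> live" for n
  proof -
    have "\<not> forces D Sg K (\<lambda>_. False) (target q\<^sub>0 (prefix n ?r))"
      using beats_not_forces[OF Sg_nonempty] set_subsequence_words[OF w]
        beats_residual[OF F run_finite_run[OF r(1)], of n "suffix n w" "suffix n r"] by simp
    then show ?thesis
      using K target_in_V[OF _ init_in_V] run_finite_run[OF r'] unfolding finite_run_def by blast
  qed
  with r' beats_acc[OF F w r] show ?thesis
    by (rule that)
qed

text \<open>The strategy leaves the run \<open>r\<close> as soon as the word deviates from \<open>w\<close>.\<close>

lemma strategy_through_run:
  assumes r: "run D q\<^sub>0 w r" and live: "\<And>n. target q\<^sub>0 (prefix n r) \<in> live"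
  shows "\<exists>\<rho>. strategy D Sg q\<^sub>0 \<rho> \<and> (w \<in> words Sg \<longrightarrow> \<rho> w = r)"
proof -
  define Inv where "Inv h \<longleftrightarrow> target q\<^sub>0 h \<in> live \<and>
    (map lbl h = prefix (length h) w \<longrightarrow> h = prefix (length h) r)" for h
  have "Inv []"
    using live[of 0] by (simp add: Inv_def)
  moreover have "\<exists>t\<in>D. src t = target q\<^sub>0 h \<and> lbl t = a \<and> Inv (h @ [t])" if "Inv h" "a \<in> Sg" for h a
  proof (cases "map lbl h @ [a] = prefix (Suc (length h)) w")
    case True
    then have "h = prefix (length h) r" "a = w (length h)"
      using that by (auto simp: Inv_def)
    then show ?thesis
      using r live[of "Suc (length h)"] unfolding run_iff Inv_def
      by (intro bexI[of _ "r (length h)"]) auto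
  next
    case False
    then show ?thesis
      using live_step[of "target q\<^sub>0 h" a] that by (fastforce simp: Inv_def)
  qed
  ultimately obtain \<rho> where \<rho>: "strategy D Sg q\<^sub>0 \<rho>"
    "\<And>v n. v \<in> words Sg \<Longrightarrow> Inv (prefix n (\<rho> v))"
    using history_strategy[of Inv Sg D q\<^sub>0] by blast
  have "\<rho> w = r" if w: "w \<in> words Sg"
  proof
    fix n
    have "prefix (Suc n) (\<rho> w) = prefix (Suc n) r"
      using \<rho>(2)[OF w, of "Suc n"] run_finite_run[OF strategy_run[OF \<rho>(1) w], of "Suc n"]
      by (simp add: Inv_def finite_run_def)
    then show "\<rho> w n = r n"
      by simp
  qed
  with \<rho>(1) show ?thesis
    by blast
qed

definition self_dominating :: "'s set" where
  "self_dominating = {p \<in> V. dominates p p}"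

lemma init_self_dominating: "q\<^sub>0 \<in> self_dominating"
  using init_in_V dominates_init by (simp add: self_dominating_def)

definition equivalents :: "'s \<Rightarrow> 's set" where
  "equivalents p = {q. dominates p q \<and> dominates q p}"

lemma equivalents_eqD:
  assumes "equivalents p = equivalents q" "dominates q q"
  shows "dominates p q" "dominates q p"
  using assms by (auto simp: equivalents_def)

lemma equivalents_eqI: "dominates p q \<Longrightarrow> dominates q p \<Longrightarrow> equivalents p = equivalents q"
  unfolding equivalents_def using dominates_trans by blast

lemma arena_optimal: "arena optimal Sg acc self_dominating equivalents"
proof -
  interpret optimal: token_game optimal Sg acc
    by standard (rule acc_suffix)
  show ?thesis
  proof
    show "finite self_dominating" "finite Sg" "Sg \<noteq> {}"
      using finite_V finite_Sg Sg_nonempty by (simp_all add: self_dominating_def)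
    show "optimal \<subseteq> self_dominating \<times> Sg \<times> self_dominating"
      using transD by (fastforce simp: optimal_def self_dominating_def)
    show "\<exists>t\<in>optimal. src t = p \<and> lbl t = a" if "p \<in> self_dominating" "a \<in> Sg" for p a
      using ex_optimal that by (simp add: self_dominating_def)
    show "equivalents (tgt t) = equivalents (tgt t')"
      if t: "t \<in> optimal" "t' \<in> optimal" "lbl t = lbl t'"
        "equivalents (src t) = equivalents (src t')"
      for t t'
    proof (rule equivalents_eqI)
      have "dominates (src t) (src t')" "dominates (src t') (src t)" "lbl t \<in> Sg" "t \<in> D" "t' \<in> D"
        using equivalents_eqD[OF t(4)] t(1,2) transD by (auto simp: optimal_def)
      with t show "dominates (tgt t) (tgt t')" "dominates (tgt t') (tgt t)"
        by (simp_all add: optimal_dominates)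
    qed
    show "optimal.dominates p q"
      if "p \<in> self_dominating" "q \<in> self_dominating" "equivalents p = equivalents q" for p q
      using dominates_optimal equivalents_eqD[OF that(3)] that(2) by (simp add: self_dominating_def)
  qed
qed

lemma accepting_optimal_run:
  assumes w: "w \<in> words Sg" and r: "run D q\<^sub>0 w r" "acc r"
  shows "\<exists>f. run optimal q\<^sub>0 w f \<and> acc f"
proof -
  interpret optimal: arena optimal Sg acc self_dominating equivalents
    by (rule arena_optimal)
  obtain r' where r': "run D q\<^sub>0 w r'" "acc r'" "\<And>n. target q\<^sub>0 (prefix n r') \<in> live"
    by (rule accepting_live_run[OF w r]) blast
  obtain \<rho> where \<rho>: "strategy D Sg q\<^sub>0 \<rho>" "\<rho> w = r'"
    using strategy_through_run[OF r'(1,3)] w by blast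
  obtain z where z: "run optimal q\<^sub>0 w z"
    using optimal.default_strategy[OF init_self_dominating] w by (auto simp: strategy_def)
  then have zD: "run D q\<^sub>0 w z"
    using optimal_subset by (rule run_mono)
  let ?f = "T w (\<rho> w) z"
  have F: "beats 1 (\<lambda>w. T w (\<rho> w)) q\<^sub>0 q\<^sub>0"
    by (rule beats_with_second_token[OF \<rho>(1)])
  have "?f n \<in> optimal" for n
    by (rule beats_optimal_move[OF F dominates_init w run_finite_run[OF z]])
  then have "run optimal q\<^sub>0 w ?f"
    using beats_run[OF F w zD] by (simp add: run_iff)
  moreover have "acc ?f"
    using T_wins[OF w strategy_run[OF \<rho>(1) w] zD] r'(2) by (simp add: \<rho>(2))
  ultimately show ?thesis
    by blast
qed

lemma resolvable_optimal_imp_resolvable: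
  assumes "resolvable optimal Sg acc q\<^sub>0"
  shows "resolvable D Sg acc q\<^sub>0"
proof -
  obtain R where R: "strategy optimal Sg q\<^sub>0 R"
    "\<And>w f. w \<in> words Sg \<Longrightarrow> run optimal q\<^sub>0 w f \<Longrightarrow> acc f \<Longrightarrow> acc (R w)"
    using assms unfolding resolvable_def by blast
  have "strategy D Sg q\<^sub>0 R"
    using R(1) optimal_subset by (rule strategy_mono)
  moreover have "acc (R w)" if "w \<in> words Sg" "run D q\<^sub>0 w r" "acc r" for w r
    using accepting_optimal_run[OF that] R(2)[OF that(1)] by blast
  ultimately show ?thesis
    unfolding resolvable_def by blast
qed

theorem gen_buchi_resolvable:
  assumes "\<And>r. acc r \<longleftrightarrow> gen_buchi C (\<lambda>i. co (r i))" "finite C"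
  shows "resolvable D Sg acc q\<^sub>0"
proof -
  interpret optimal: buchi_arena optimal Sg acc self_dominating equivalents co C
    by (intro buchi_arena.intro buchi_arena_axioms.intro arena_optimal assms)
  show ?thesis
    by (intro resolvable_optimal_imp_resolvable optimal.buchi_resolvable init_self_dominating)
qed

theorem gen_cobuchi_resolvable:
  assumes "\<And>r. acc r \<longleftrightarrow> gen_cobuchi C (\<lambda>i. co (r i))" "finite C"
  shows "resolvable D Sg acc q\<^sub>0"
proof -
  interpret optimal: cobuchi_arena optimal Sg acc self_dominating equivalents co C
    by (intro cobuchi_arena.intro cobuchi_arena_axioms.intro arena_optimal assms)
  show ?thesis
    by (intro resolvable_optimal_imp_resolvable optimal.cobuchi_resolvable init_self_dominating)
qed

end

section \<open>History-determinism and the two-token game\<close>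

lemma eventually_sequentially_suffix:
  "(\<forall>\<^sub>F i in sequentially. P (suffix n x i)) \<longleftrightarrow> (\<forall>\<^sub>F i in sequentially. P (x i))"
  using eventually_sequentially_seg[of "\<lambda>i. P (x i)" n] by (simp add: add.commute)

lemma gen_buchi_suffix: "gen_buchi C (suffix n x) \<longleftrightarrow> gen_buchi C x"
  using eventually_sequentially_suffix[of "\<lambda>y. c \<notin> y" n x for c]
  by (simp add: gen_buchi_def frequently_def cofinite_eq_sequentially)

lemma gen_cobuchi_suffix: "gen_cobuchi C (suffix n x) \<longleftrightarrow> gen_cobuchi C x"
  using eventually_sequentially_suffix[of "\<lambda>y. c \<notin> y" n x for c]
  by (simp add: gen_cobuchi_def eventually_cofinite flip: cofinite_eq_sequentially)

lemma run_prefix_iff: "run_prefix A w r n \<longleftrightarrow> finite_run (delta A) (init A) (prefix n w) (prefix n r)"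
proof (induction n)
  case (Suc n)
  have "run_prefix A w r (Suc n) \<longleftrightarrow> run_prefix A w r n \<and> r n \<in> delta A \<and> lbl (r n) = w n \<and>
      src (r n) = (if n = 0 then init A else tgt (r (n - 1)))"
    unfolding run_prefix_def less_Suc_eq by blast
  also have "(if n = 0 then init A else tgt (r (n - 1))) = target (init A) (prefix n r)"
    by (cases n) simp_all
  finally show ?case
    using Suc by (auto simp: finite_run_snoc)
qed (simp add: run_prefix_def)

lemma is_run_iff: "is_run A w r \<longleftrightarrow> run (delta A) (init A) w r"
  by (simp add: is_run_def run_prefix_iff run_def)

lemma is_word_iff: "is_word A w \<longleftrightarrow> w \<in> words (alphabet A)"
  by (auto simp: is_word_def words_def)

lemma pref_eq_prefix: "pref w n = prefix n w"
  by (simp add: pref_def subsequence_def)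

lemma resolvable_imp_history_deterministic:
  assumes "resolvable (delta A) (alphabet A) (accepting A W) (init A)"
  shows "history_deterministic A W"
proof -
  obtain R where R: "strategy (delta A) (alphabet A) (init A) R"
    and acc: "\<And>w r. is_word A w \<Longrightarrow> is_run A w r \<Longrightarrow> accepting A W r \<Longrightarrow> accepting A W (R w)"
    using assms unfolding resolvable_def is_word_iff is_run_iff by blast
  define \<sigma> where "\<sigma> u = last (prefix (length u) (R (u \<frown> undefined)))" for u
  have "prefix (Suc i) (R (prefix (Suc i) w \<frown> undefined)) = prefix (Suc i) (R w)" for i w
    by (rule causalD[OF strategy_causal[OF R]]) simp
  then have "\<sigma> (prefix (Suc i) w) = R w i" for i w
    by (simp add: \<sigma>_def)
  then have "(\<lambda>i. \<sigma> (pref w (Suc i))) = R w" for w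
    by (simp add: pref_eq_prefix)
  then have "is_resolver A W \<sigma>"
    using acc strategy_run[OF R] by (auto simp: is_resolver_def lang_def is_word_iff is_run_iff)
  then show ?thesis
    by (auto simp: history_deterministic_def)
qed

lemma history_deterministic_imp_eve_wins_G2:
  assumes "history_deterministic A W"
  shows "eve_wins_G2 A W"
proof -
  obtain \<sigma> where \<sigma>: "is_resolver A W \<sigma>"
    using assms by (auto simp: history_deterministic_def)
  define \<tau> where "\<tau> u v = \<sigma> u" for u and v :: "(('a,'b) trans \<times> ('a,'b) trans) list"
  have play: "eve_play \<tau> w t\<^sub>1 t\<^sub>2 = (\<lambda>i. \<sigma> (pref w (Suc i)))" for w t\<^sub>1 t\<^sub>2
    by (simp add: eve_play_def \<tau>_def fun_eq_iff)
  show ?thesis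
    unfolding eve_wins_G2_def
  proof (intro exI[of _ \<tau>] conjI allI impI; unfold play)
    fix w t\<^sub>1 t\<^sub>2 n
    assume "is_word A w"
    then show "run_prefix A w (\<lambda>i. \<sigma> (pref w (Suc i))) (Suc n)"
      using \<sigma> unfolding is_resolver_def is_run_def by blast
  next
    fix w t\<^sub>1 t\<^sub>2
    assume "is_word A w" "is_run A w t\<^sub>1" "is_run A w t\<^sub>2"
    then show "accepting A W (\<lambda>i. \<sigma> (pref w (Suc i))) \<or> \<not> accepting A W t\<^sub>1 \<and> \<not> accepting A W t\<^sub>2"
      using \<sigma> unfolding is_resolver_def lang_def by blast
  qed
qed

lemma two_token_game_eve_play:
  assumes wf: "wf_automaton A" and ne: "alphabet A \<noteq> {}"
    and W: "\<And>n x. W (suffix n x) \<longleftrightarrow> W x"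
    and legal: "\<And>w t\<^sub>1 t\<^sub>2 n. is_word A w \<Longrightarrow> run_prefix A w t\<^sub>1 n \<Longrightarrow> run_prefix A w t\<^sub>2 n \<Longrightarrow>
      run_prefix A w (eve_play \<tau> w t\<^sub>1 t\<^sub>2) (Suc n)"
    and wins: "\<And>w t\<^sub>1 t\<^sub>2. is_word A w \<Longrightarrow> is_run A w t\<^sub>1 \<Longrightarrow> is_run A w t\<^sub>2 \<Longrightarrow>
      accepting A W (eve_play \<tau> w t\<^sub>1 t\<^sub>2) \<or> (\<not> accepting A W t\<^sub>1 \<and> \<not> accepting A W t\<^sub>2)"
  shows "two_token_game (delta A) (alphabet A) (accepting A W) (states A) (init A) (eve_play \<tau>)"
proof
  show "accepting A W (suffix n r) \<longleftrightarrow> accepting A W r" for n r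
    using W[of n "\<lambda>i. col A (r i)"] by (simp add: accepting_def suffix_def)
  show "finite (states A)" "finite (alphabet A)" "init A \<in> states A" "alphabet A \<noteq> {}"
    "delta A \<subseteq> states A \<times> alphabet A \<times> states A"
    using wf ne by (auto simp: wf_automaton_def)
  show "prefix n (eve_play \<tau> w t s) = prefix n (eve_play \<tau> w' t' s')"
    if w: "prefix n w = prefix n w'" and t: "prefix (n - 1) t = prefix (n - 1) t'"
      and s: "prefix (n - 1) s = prefix (n - 1) s'" for n w w' t t' s s'
  proof -
    have zip: "map (\<lambda>j. (x j, y j)) [0..<i] = zip (prefix i x) (prefix i y)"
      for x y :: "('a,'b) trans word" and i
      by (rule nth_equalityI) simp_all
    have "eve_play \<tau> w t s i = eve_play \<tau> w' t' s' i" if "i < n" for i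
      using that prefix_eq_mono[OF w, of "Suc i"] prefix_eq_mono[OF t, of i]
        prefix_eq_mono[OF s, of i]
      by (simp only: eve_play_def pref_eq_prefix zip)
    then show ?thesis
      by (simp add: subsequence_def)
  qed
qed (use legal wins in \<open>simp_all add: is_word_iff run_prefix_iff is_run_iff, blast\<close>)

lemma eve_wins_G2_imp_history_deterministic:
  assumes wf: "wf_automaton A" and W: "W = gen_buchi (colours A) \<or> W = gen_cobuchi (colours A)"
    and "eve_wins_G2 A W"
  shows "history_deterministic A W"
proof (rule resolvable_imp_history_deterministic, cases "alphabet A = {}")
  case True
  then show "resolvable (delta A) (alphabet A) (accepting A W) (init A)"
    using causal_const by (auto simp: resolvable_def strategy_def words_def)
next
  case False
  have "W (suffix n x) \<longleftrightarrow> W x" for n x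
    using W gen_buchi_suffix gen_cobuchi_suffix by metis
  with assms(3) obtain \<tau>
    where "two_token_game (delta A) (alphabet A) (accepting A W) (states A) (init A) (eve_play \<tau>)"
    unfolding eve_wins_G2_def using two_token_game_eve_play[OF wf False] by metis
  then interpret
    two_token_game "delta A" "alphabet A" "accepting A W" "states A" "init A" "eve_play \<tau>" .
  have "finite (colours A)"
    using wf by (simp add: wf_automaton_def)
  with W show "resolvable (delta A) (alphabet A) (accepting A W) (init A)"
    using gen_buchi_resolvable[of "colours A" "col A"]
      gen_cobuchi_resolvable[of "colours A" "col A"]
    by (auto simp: accepting_def)
qed

theorem theorem37:
  fixes A :: "('q,'a,'c) automaton" and W :: "(nat \<Rightarrow> 'c set) \<Rightarrow> bool"
  assumes "wf_automaton A"
    and "W = gen_buchi (colours A) \<or> W = gen_cobuchi (colours A)"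
  shows "history_deterministic A W \<longleftrightarrow> eve_wins_G2 A W"
  using history_deterministic_imp_eve_wins_G2 eve_wins_G2_imp_history_deterministic[OF assms]
  by blast

end
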